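(* A Clifford monoid $S$ is of type $\mathrm{FP}_n$ if and only if it has a minimal idempotent $e$ and the maximal subgroup $G_e$ of $S$ containing $e$ is of type $\mathrm{FP}_n$.
   Context: For a monoid $S$, $\mathbb{Z}S$ denotes the integral monoid ring, and $\mathbb{Z}$ is regarded as the trivial left $\mathbb{Z}S$-module via the augmentation $\epsilon_S:\mathbb{Z}S\to\mathbb{Z}$, $s\mapsto 1$ ($s\in S$). For $n\geq 0$ the monoid $S$ is of type left-$\mathrm{FP}_n$ if there is an exact sequence $A_n\to A_{n-1}\to\cdots\to A_0\to\mathbb{Z}\to 0$ of left $\mathbb{Z}S$-modules with $A_0,\ldots,A_n$ finitely generated free left $\mathbb{Z}S$-modules; right-$\mathrm{FP}_n$ is dual. A semigroup without a two-sided identity is of type left- (right-) $\mathrm{FP}_n$ if the monoid obtained by adjoining an identity is. For inverse semigroups (in particular for groups and Clifford monoids) left-$\mathrm{FP}_n$ and right-$\mathrm{FP}_n$ are equivalent, and one says "type $\mathrm{FP}_n$". A Clifford monoid is a (von Neumann) regular semigroup (for every $x$ there is $y$ with $xyx=x$) whose idempotents are central. "Minimal idempotent" refers to the natural partial order on idempotents, $e\leq f$ iff $ef=fe=e$. The maximal subgroup $G_e$ containing an idempotent $e$ is the group of units of $eSe$.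
   Formalization: The formal theorem assumes n ≥ 1; for n = 0 the claim fails, since every monoid is of type FP_0 while the Clifford monoid (ℕ, max) has no minimal idempotent. *)

theory Defs
  imports "HOL-Library.Poly_Mapping" "HOL-Algebra.Module" "HOL-Algebra.AbelCoset"
begin

section \<open>Clifford monoids and maximal subgroups\<close>

definition idempotents :: "('a, 'b) monoid_scheme \<Rightarrow> 'a set" where
  "idempotents S = {e \<in> carrier S. e \<otimes>\<^bsub>S\<^esub> e = e}"

locale clifford_monoid = monoid S for S (structure) +
  assumes regular: "x \<in> carrier S \<Longrightarrow> \<exists>y\<in>carrier S. x \<otimes> y \<otimes> x = x"
    and idempotents_central:
      "\<lbrakk>e \<in> idempotents S; x \<in> carrier S\<rbrakk> \<Longrightarrow> e \<otimes> x = x \<otimes> e"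

definition natural_le :: "('a, 'b) monoid_scheme \<Rightarrow> 'a \<Rightarrow> 'a \<Rightarrow> bool" where
  "natural_le S e f \<longleftrightarrow> e \<otimes>\<^bsub>S\<^esub> f = e \<and> f \<otimes>\<^bsub>S\<^esub> e = e"

definition minimal_idempotent :: "('a, 'b) monoid_scheme \<Rightarrow> 'a \<Rightarrow> bool" where
  "minimal_idempotent S e \<longleftrightarrow>
     e \<in> idempotents S \<and> (\<forall>f\<in>idempotents S. natural_le S f e \<longrightarrow> f = e)"

definition local_submonoid :: "('a, 'b) monoid_scheme \<Rightarrow> 'a \<Rightarrow> 'a monoid" where
  "local_submonoid S e =
     \<lparr>carrier = {e \<otimes>\<^bsub>S\<^esub> x \<otimes>\<^bsub>S\<^esub> e | x. x \<in> carrier S}, monoid.mult = monoid.mult S, one = e\<rparr>"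

definition maximal_subgroup :: "('a, 'b) monoid_scheme \<Rightarrow> 'a \<Rightarrow> 'a monoid" where
  "maximal_subgroup S e = units_of (local_submonoid S e)"


section \<open>The integral monoid ring and its left modules\<close>

text \<open>
  The elements of the monoid ring are those of the free abelian group on the carrier of \<open>S\<close>;
  \<^const>\<open>frag_extend\<close> is linear extension, so the product is the bilinear extension of
  the product of \<open>S\<close>.
\<close>

definition monoid_ring :: "('a, 'b) monoid_scheme \<Rightarrow> ('a \<Rightarrow>\<^sub>0 int) ring" where
  "monoid_ring S =
     \<lparr>carrier = {p. Poly_Mapping.keys p \<subseteq> carrier S},
      monoid.mult = (\<lambda>p q. frag_extend (\<lambda>x. frag_extend (\<lambda>y. frag_of (x \<otimes>\<^bsub>S\<^esub> y)) q) p),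
      one = frag_of \<one>\<^bsub>S\<^esub>,
      ring.zero = 0,
      ring.add = (+)\<rparr>"

definition augmentation :: "('a \<Rightarrow>\<^sub>0 int) \<Rightarrow> int" where
  "augmentation p = (\<Sum>x\<in>Poly_Mapping.keys p. Poly_Mapping.lookup p x)"

text \<open>
  The locale \<^locale>\<open>module\<close> of the library requires a commutative ring of scalars; only that
  requirement is dropped here. As there, the multiplication and the unit in the record of a module
  carry no information.
\<close>

locale left_module = R: ring R + M: abelian_group M
  for R :: "('r, 'c) ring_scheme" and M :: "('r, 'm, 'd) module_scheme" +
  assumes smult_closed:
      "\<lbrakk>a \<in> carrier R; x \<in> carrier M\<rbrakk> \<Longrightarrow> a \<odot>\<^bsub>M\<^esub> x \<in> carrier M"
    and smult_l_distr:
      "\<lbrakk>a \<in> carrier R; b \<in> carrier R; x \<in> carrier M\<rbrakk> \<Longrightarrow>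
       (a \<oplus>\<^bsub>R\<^esub> b) \<odot>\<^bsub>M\<^esub> x = a \<odot>\<^bsub>M\<^esub> x \<oplus>\<^bsub>M\<^esub> b \<odot>\<^bsub>M\<^esub> x"
    and smult_r_distr:
      "\<lbrakk>a \<in> carrier R; x \<in> carrier M; y \<in> carrier M\<rbrakk> \<Longrightarrow>
       a \<odot>\<^bsub>M\<^esub> (x \<oplus>\<^bsub>M\<^esub> y) = a \<odot>\<^bsub>M\<^esub> x \<oplus>\<^bsub>M\<^esub> a \<odot>\<^bsub>M\<^esub> y"
    and smult_assoc:
      "\<lbrakk>a \<in> carrier R; b \<in> carrier R; x \<in> carrier M\<rbrakk> \<Longrightarrow>
       (a \<otimes>\<^bsub>R\<^esub> b) \<odot>\<^bsub>M\<^esub> x = a \<odot>\<^bsub>M\<^esub> (b \<odot>\<^bsub>M\<^esub> x)"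
    and smult_one:
      "x \<in> carrier M \<Longrightarrow> \<one>\<^bsub>R\<^esub> \<odot>\<^bsub>M\<^esub> x = x"

definition left_module_hom ::
    "('r, 'c) ring_scheme \<Rightarrow> ('r, 'm, 'd) module_scheme \<Rightarrow> ('r, 'n, 'e) module_scheme \<Rightarrow> ('m \<Rightarrow> 'n) set"
  where
  "left_module_hom R M N =
     {h \<in> hom (add_monoid M) (add_monoid N).
        \<forall>a\<in>carrier R. \<forall>x\<in>carrier M. h (a \<odot>\<^bsub>M\<^esub> x) = a \<odot>\<^bsub>N\<^esub> h x}"

definition module_basis ::
    "('r, 'c) ring_scheme \<Rightarrow> ('r, 'm, 'd) module_scheme \<Rightarrow> 'm set \<Rightarrow> bool" where
  "module_basis R M B \<longleftrightarrow>
     finite B \<and> B \<subseteq> carrier M \<and>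
     (\<forall>x\<in>carrier M. \<exists>!c. c \<in> B \<rightarrow>\<^sub>E carrier R \<and> x = (\<Oplus>\<^bsub>M\<^esub>b\<in>B. c b \<odot>\<^bsub>M\<^esub> b))"

definition fg_free_left_module ::
    "('r, 'c) ring_scheme \<Rightarrow> ('r, 'm, 'd) module_scheme \<Rightarrow> bool" where
  "fg_free_left_module R M \<longleftrightarrow> left_module R M \<and> (\<exists>B. module_basis R M B)"

definition trivial_module :: "('a \<Rightarrow>\<^sub>0 int, int) module" where
  "trivial_module =
     \<lparr>carrier = UNIV, monoid.mult = (*), one = 1, ring.zero = 0, ring.add = (+),
      smult = (\<lambda>p k. augmentation p * k)\<rparr>"


section \<open>Homological finiteness properties\<close>

text \<open>
  The modules \<open>A 0, \<dots>, A n\<close> have to share one carrier type. The type \<open>nat \<Rightarrow> 'a \<Rightarrow>\<^sub>0 int\<close> is large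
  enough to contain an isomorphic copy of every finitely generated free module, namely the
  functions with values in the carrier of the monoid ring that vanish outside \<open>{..<k}\<close>, for each
  rank \<open>k\<close>. There is no exactness condition at \<open>A n\<close>.
\<close>

definition left_FP :: "nat \<Rightarrow> ('a, 'b) monoid_scheme \<Rightarrow> bool" where
  "left_FP n S \<longleftrightarrow>
     (\<exists>(A :: nat \<Rightarrow> ('a \<Rightarrow>\<^sub>0 int, nat \<Rightarrow> 'a \<Rightarrow>\<^sub>0 int) module)
        (\<epsilon> :: (nat \<Rightarrow> 'a \<Rightarrow>\<^sub>0 int) \<Rightarrow> int)
        (d :: nat \<Rightarrow> (nat \<Rightarrow> 'a \<Rightarrow>\<^sub>0 int) \<Rightarrow> (nat \<Rightarrow> 'a \<Rightarrow>\<^sub>0 int)).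
        (\<forall>i\<le>n. fg_free_left_module (monoid_ring S) (A i)) \<and>
        \<epsilon> \<in> left_module_hom (monoid_ring S) (A 0) trivial_module \<and>
        (\<forall>i<n. d i \<in> left_module_hom (monoid_ring S) (A (Suc i)) (A i)) \<and>
        \<epsilon> ` carrier (A 0) = carrier (trivial_module :: ('a \<Rightarrow>\<^sub>0 int, int) module) \<and>
        (0 < n \<longrightarrow>
           d 0 ` carrier (A 1) =
           a_kernel (A 0) (trivial_module :: ('a \<Rightarrow>\<^sub>0 int, int) module) \<epsilon>) \<and>
        (\<forall>i. Suc i < n \<longrightarrow>
           d (Suc i) ` carrier (A (Suc (Suc i))) = a_kernel (A (Suc i)) (A i) (d i)))"

definition opposite_monoid :: "('a, 'b) monoid_scheme \<Rightarrow> 'a monoid" where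
  "opposite_monoid S = \<lparr>carrier = carrier S, monoid.mult = (\<lambda>x y. y \<otimes>\<^bsub>S\<^esub> x), one = \<one>\<^bsub>S\<^esub>\<rparr>"

text \<open>Right modules over the monoid ring of \<open>S\<close> are left modules over that of the opposite monoid.\<close>

definition right_FP :: "nat \<Rightarrow> ('a, 'b) monoid_scheme \<Rightarrow> bool" where
  "right_FP n S \<longleftrightarrow> left_FP n (opposite_monoid S)"

text \<open>
  For inverse semigroups \<^const>\<open>left_FP\<close> and \<^const>\<open>right_FP\<close> are equivalent, so there the
  following notion coincides with each of them. Every monoid is of type left- and right-FP in
  degree 0, by the augmentation map alone.
\<close>

definition type_FP :: "nat \<Rightarrow> ('a, 'b) monoid_scheme \<Rightarrow> bool" where
  "type_FP n S \<longleftrightarrow> left_FP n S \<and> right_FP n S"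

end

theory Submission
  imports Defs "HOL-Library.Nat_Bijection"
begin

text \<open>
  Let \<open>e\<close> be a minimal idempotent of a Clifford monoid \<open>S\<close>. Since idempotents are central, \<open>e g = e\<close>
  for every idempotent \<open>g\<close>, and hence \<open>e x y = e\<close> whenever \<open>x y\<close> is the idempotent that regularity
  attaches to \<open>x\<close>. So all of \<open>e S\<close> consists of units: \<open>e S\<close> is the maximal subgroup \<open>G\<close> at \<open>e\<close>, and its
  group ring is the corner \<open>e \<int>S\<close> of \<open>\<int>S\<close> cut out by the central idempotent \<open>e\<close>
  (\<open>monoid_ring_maximal_subgroup\<close>). The trivial module is unaffected by \<open>e\<close>. The equivalence
  between \<open>S\<close> and \<open>G\<close> is then a statement about an arbitrary ring \<open>R\<close> with a central idempotent \<open>e\<close>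
  and a module on which \<open>e\<close> acts as the identity (\<open>left_FP_maximal_subgroup_iff\<close>).

  In one direction, \<open>M \<mapsto> e M\<close> is exact and maps free \<open>R\<close>-modules to free \<open>e R\<close>-modules of the same
  rank (\<open>partial_free_resolution_corner_module\<close>). In the other direction, a free \<open>e R\<close>-module of rank
  \<open>k\<close> is only projective over \<open>R\<close>, with complement \<open>((1 - e) R)\<^sup>k\<close>. Adding this complement in degree
  \<open>i\<close> spoils exactness there, which is repaired by one more copy of \<open>R\<^sup>k\<close> in every higher degree, the
  maps between consecutive copies being alternately \<open>1 - e\<close> and \<open>e\<close>. Every module in the result is
  finitely generated and free (\<open>partial_free_resolution_from_corner\<close>).

  It remains to find a minimal idempotent if \<open>S\<close> is of type left-FP in a positive degree
  (\<open>left_FP_imp_minimal_idempotent\<close>). Every idempotent \<open>f\<close> gives a ring homomorphism from \<open>\<int>S\<close> to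
  \<open>\<int>\<close>, sending those \<open>x\<close> to 1 of which \<open>f\<close> is a multiple and all others to 0. Finite generation
  means that only finitely many elements of \<open>S\<close> occur in the first step of the resolution; if \<open>f\<close>
  is chosen below all of these, then its homomorphism cannot be told apart from the augmentation by
  that step, and so it takes the value 1 at every idempotent, which says that \<open>f\<close> lies below all
  idempotents.

  The statements about right modules follow by passing to the opposite monoid, which is again
  Clifford, with the same minimal idempotents and the opposite maximal subgroups.
\<close>

section \<open>The monoid ring and its characters\<close>

lemma monoid_ring_sel [simp]:
  "carrier (monoid_ring S) = {p. Poly_Mapping.keys p \<subseteq> carrier S}"
  "\<one>\<^bsub>monoid_ring S\<^esub> = frag_of \<one>\<^bsub>S\<^esub>"
  "\<zero>\<^bsub>monoid_ring S\<^esub> = 0"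
  "p \<oplus>\<^bsub>monoid_ring S\<^esub> q = p + q"
  by (simp_all add: monoid_ring_def)

lemma monoid_ring_mult:
  "p \<otimes>\<^bsub>monoid_ring S\<^esub> q = frag_extend (\<lambda>x. frag_extend (\<lambda>y. frag_of (x \<otimes>\<^bsub>S\<^esub> y)) q) p"
  by (simp add: monoid_ring_def)

lemma monoid_ring_mult_of [simp]:
  "frag_of x \<otimes>\<^bsub>monoid_ring S\<^esub> frag_of y = frag_of (x \<otimes>\<^bsub>S\<^esub> y)"
  by (simp add: monoid_ring_mult)

lemma monoid_ring_mult_zero [simp]:
  "0 \<otimes>\<^bsub>monoid_ring S\<^esub> q = 0" "p \<otimes>\<^bsub>monoid_ring S\<^esub> 0 = 0"
  by (simp_all add: monoid_ring_mult frag_extend_eq_0)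

lemma monoid_ring_mult_diff_left:
  "(p - p') \<otimes>\<^bsub>monoid_ring S\<^esub> q = p \<otimes>\<^bsub>monoid_ring S\<^esub> q - p' \<otimes>\<^bsub>monoid_ring S\<^esub> q"
  by (simp add: monoid_ring_mult frag_extend_diff)

lemma monoid_ring_mult_add_left:
  "(p + p') \<otimes>\<^bsub>monoid_ring S\<^esub> q = p \<otimes>\<^bsub>monoid_ring S\<^esub> q + p' \<otimes>\<^bsub>monoid_ring S\<^esub> q"
  by (simp add: monoid_ring_mult frag_extend_add)

lemma monoid_ring_mult_diff_right:
  "p \<otimes>\<^bsub>monoid_ring S\<^esub> (q - q') = p \<otimes>\<^bsub>monoid_ring S\<^esub> q - p \<otimes>\<^bsub>monoid_ring S\<^esub> q'"
  using subset_UNIV[of "Poly_Mapping.keys p"]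
proof (induction p rule: frag_induction)
  case (one x)
  then show ?case by (simp add: monoid_ring_mult frag_extend_diff)
qed (simp_all add: monoid_ring_mult_diff_left)

lemma monoid_ring_mult_add_right:
  "p \<otimes>\<^bsub>monoid_ring S\<^esub> (q + q') = p \<otimes>\<^bsub>monoid_ring S\<^esub> q + p \<otimes>\<^bsub>monoid_ring S\<^esub> q'"
  using monoid_ring_mult_diff_right[where S = S and p = p and q = "q + q'" and q' = q'] by (simp add: algebra_simps)

lemma keys_monoid_ring_mult:
  "Poly_Mapping.keys (p \<otimes>\<^bsub>monoid_ring S\<^esub> q)
     \<subseteq> {x \<otimes>\<^bsub>S\<^esub> y |x y. x \<in> Poly_Mapping.keys p \<and> y \<in> Poly_Mapping.keys q}"
  unfolding monoid_ring_mult
  by (rule order_trans[OF keys_frag_extend])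
     (fastforce dest!: subsetD[OF keys_frag_extend])

text \<open>
  Every identity between multilinear expressions, such as associativity, reduces to the
  generators \<open>frag_of x\<close>, where it is the same identity in the monoid.
\<close>

lemma monoid_ring_is_ring:
  assumes "monoid S"
  shows "ring (monoid_ring S)"
proof -
  interpret monoid S by fact
  let ?R = "monoid_ring S"
  have assoc: "(p \<otimes>\<^bsub>?R\<^esub> q) \<otimes>\<^bsub>?R\<^esub> r = p \<otimes>\<^bsub>?R\<^esub> (q \<otimes>\<^bsub>?R\<^esub> r)"
    if p: "Poly_Mapping.keys p \<subseteq> carrier S" and q: "Poly_Mapping.keys q \<subseteq> carrier S"
      and r: "Poly_Mapping.keys r \<subseteq> carrier S" for p q r
    using p
  proof (induction p rule: frag_induction)
    case (one x)
    show ?case using q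
    proof (induction q rule: frag_induction)
      case (one y)
      show ?case using r
        by (induction r rule: frag_induction)
          (simp_all add: \<open>x \<in> carrier S\<close> \<open>y \<in> carrier S\<close> m_assoc monoid_ring_mult_diff_right)
    qed (simp_all add: monoid_ring_mult_diff_left monoid_ring_mult_diff_right)
  qed (simp_all add: monoid_ring_mult_diff_left)
  have one_l: "frag_of \<one>\<^bsub>S\<^esub> \<otimes>\<^bsub>?R\<^esub> p = p" if "Poly_Mapping.keys p \<subseteq> carrier S" for p
    using that by (induction p rule: frag_induction) (simp_all add: monoid_ring_mult_diff_right)
  have one_r: "p \<otimes>\<^bsub>?R\<^esub> frag_of \<one>\<^bsub>S\<^esub> = p" if "Poly_Mapping.keys p \<subseteq> carrier S" for p
    using that by (induction p rule: frag_induction) (simp_all add: monoid_ring_mult_diff_left)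
  show ?thesis
  proof (rule ringI)
    show "abelian_group ?R"
    proof (rule abelian_groupI)
      show "\<exists>y\<in>carrier ?R. y \<oplus>\<^bsub>?R\<^esub> x = \<zero>\<^bsub>?R\<^esub>" if "x \<in> carrier ?R" for x
        using that by (intro bexI[of _ "- x"]) auto
      show "x \<oplus>\<^bsub>?R\<^esub> y \<in> carrier ?R" if "x \<in> carrier ?R" "y \<in> carrier ?R" for x y
        using that Poly_Mapping.keys_add[of x y] by auto
    qed (auto simp: algebra_simps)
    show "monoid ?R"
    proof (rule monoidI)
      show "x \<otimes>\<^bsub>?R\<^esub> y \<in> carrier ?R" if "x \<in> carrier ?R" "y \<in> carrier ?R" for x y
        using that keys_monoid_ring_mult[of S x y] by fastforce
    qed (auto simp: assoc one_l one_r)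
  qed (auto simp: monoid_ring_mult_add_left monoid_ring_mult_add_right)
qed

definition linear_extension :: "('a \<Rightarrow> int) \<Rightarrow> ('a \<Rightarrow>\<^sub>0 int) \<Rightarrow> int" where
  "linear_extension w p = (\<Sum>x\<in>Poly_Mapping.keys p. Poly_Mapping.lookup p x * w x)"

lemma augmentation_linear_extension: "augmentation = linear_extension (\<lambda>_. 1)"
  by (simp add: fun_eq_iff augmentation_def linear_extension_def)

text \<open>
  The integers are the free abelian group on one generator; this makes the linearity of
  \<^const>\<open>frag_extend\<close> available.
\<close>

lemma linear_extension_frag_extend:
  "linear_extension w p = Poly_Mapping.lookup (frag_extend (\<lambda>x. frag_cmul (w x) (frag_of ())) p) ()"
  by (simp add: linear_extension_def frag_extend_def lookup_sum)

lemma linear_extension_simps [simp]: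
  "linear_extension w 0 = 0"
  "linear_extension w (frag_of x) = w x"
  "linear_extension w (p + q) = linear_extension w p + linear_extension w q"
  "linear_extension w (p - q) = linear_extension w p - linear_extension w q"
  by (simp_all add: linear_extension_frag_extend frag_extend_add frag_extend_diff
      lookup_add lookup_minus)

text \<open>
  A homomorphism from \<open>S\<close> to the multiplicative monoid of the integers extends to a ring
  homomorphism; the augmentation is the case of the constant homomorphism.
\<close>

lemma linear_extension_mult:
  assumes w: "\<And>x y. \<lbrakk>x \<in> carrier S; y \<in> carrier S\<rbrakk> \<Longrightarrow> w (x \<otimes>\<^bsub>S\<^esub> y) = w x * w y"
    and p: "Poly_Mapping.keys p \<subseteq> carrier S" and q: "Poly_Mapping.keys q \<subseteq> carrier S"
  shows "linear_extension w (p \<otimes>\<^bsub>monoid_ring S\<^esub> q) = linear_extension w p * linear_extension w q"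
  using p
proof (induction p rule: frag_induction)
  case (one x)
  show ?case using q
    by (induction q rule: frag_induction)
      (simp_all add: w one monoid_ring_mult_diff_right right_diff_distrib)
qed (simp_all add: monoid_ring_mult_diff_left left_diff_distrib)

lemma linear_extension_eq_augmentation:
  "(\<And>x. x \<in> Poly_Mapping.keys p \<Longrightarrow> w x = 1) \<Longrightarrow> linear_extension w p = augmentation p"
  by (simp add: linear_extension_def augmentation_def)

lemma trivial_module_sel [simp]:
  "carrier trivial_module = UNIV"
  "\<zero>\<^bsub>trivial_module\<^esub> = 0"
  "x \<oplus>\<^bsub>trivial_module\<^esub> y = x + y"
  "p \<odot>\<^bsub>trivial_module\<^esub> x = augmentation p * x"
  by (simp_all add: trivial_module_def)

lemma trivial_module_is_left_module:
  assumes "monoid S"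
  shows "left_module (monoid_ring S) trivial_module"
proof -
  interpret R: ring "monoid_ring S" by (rule monoid_ring_is_ring[OF assms])
  show ?thesis
  proof (intro left_module.intro left_module_axioms.intro R.ring_axioms)
    show "abelian_group trivial_module"
      by (rule abelian_groupI) (auto intro: exI[of _ "- _"])
  qed (auto simp: augmentation_linear_extension linear_extension_mult[where S = S] algebra_simps)
qed

section \<open>Finite bases and coordinates\<close>

text \<open>
  Stated for additive maps, so as to cover module homomorphisms, the action of one scalar, the
  evaluation of functions at a point, and inclusions alike.
\<close>

lemma hom_finsum:
  assumes M: "abelian_group M" and N: "abelian_group N"
    and h: "h \<in> hom (add_monoid M) (add_monoid N)"
    and I: "finite I" and f: "f \<in> I \<rightarrow> carrier M"
  shows "h (\<Oplus>\<^bsub>M\<^esub>i\<in>I. f i) = (\<Oplus>\<^bsub>N\<^esub>i\<in>I. h (f i))"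
proof -
  interpret M: abelian_group M by fact
  interpret N: abelian_group N by fact
  have h_closed: "h x \<in> carrier N" if "x \<in> carrier M" for x
    using h that by (auto simp: hom_def)
  have h_add: "h (x \<oplus>\<^bsub>M\<^esub> y) = h x \<oplus>\<^bsub>N\<^esub> h y" if "x \<in> carrier M" "y \<in> carrier M" for x y
    using h that by (auto simp: hom_def)
  have h_zero: "h \<zero>\<^bsub>M\<^esub> = \<zero>\<^bsub>N\<^esub>"
    using h_add[of "\<zero>\<^bsub>M\<^esub>" "\<zero>\<^bsub>M\<^esub>"] h_closed[of "\<zero>\<^bsub>M\<^esub>"]
    by (metis M.add.one_closed M.add.r_one N.add.r_cancel_one')
  show ?thesis using I f
  proof (induction I)
    case (insert i I)
    have "f i \<in> carrier M" "f \<in> I \<rightarrow> carrier M" using insert.prems by auto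
    then show ?case using insert by (simp add: h_add h_closed M.finsum_closed Pi_iff)
  qed (simp add: h_zero)
qed

context left_module
begin

lemma smult_l_zero: "x \<in> carrier M \<Longrightarrow> \<zero>\<^bsub>R\<^esub> \<odot>\<^bsub>M\<^esub> x = \<zero>\<^bsub>M\<^esub>"
  by (metis M.add.r_cancel_one' R.add.one_closed R.add.r_one smult_closed smult_l_distr)

lemma smult_r_zero: "a \<in> carrier R \<Longrightarrow> a \<odot>\<^bsub>M\<^esub> \<zero>\<^bsub>M\<^esub> = \<zero>\<^bsub>M\<^esub>"
  by (metis M.add.one_closed M.add.r_cancel_one' M.add.r_one smult_closed smult_r_distr)

lemma smult_finsum:
  assumes "a \<in> carrier R" "finite I" "f \<in> I \<rightarrow> carrier M"
  shows "a \<odot>\<^bsub>M\<^esub> (\<Oplus>\<^bsub>M\<^esub>i\<in>I. f i) = (\<Oplus>\<^bsub>M\<^esub>i\<in>I. a \<odot>\<^bsub>M\<^esub> f i)"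
  using hom_finsum[OF M.abelian_group_axioms M.abelian_group_axioms, of "\<lambda>x. a \<odot>\<^bsub>M\<^esub> x"] assms
  by (auto simp: hom_def smult_closed smult_r_distr)

end

text \<open>
  Bases as families rather than as sets: a family can be multiplied by \<open>e\<close> and reindexed without
  any injectivity argument. Over a nonzero ring its range is a basis in the sense of
  \<^const>\<open>module_basis\<close>.
\<close>

locale based_module = left_module R M
  for R :: "('r, 'c) ring_scheme" and M :: "('r, 'm, 'd) module_scheme" +
  fixes I :: "'i set" and u :: "'i \<Rightarrow> 'm"
  assumes finite_index: "finite I"
    and basis_closed: "i \<in> I \<Longrightarrow> u i \<in> carrier M"
    and ex1_coordinates: "x \<in> carrier M \<Longrightarrow>
      \<exists>!c. c \<in> I \<rightarrow>\<^sub>E carrier R \<and> x = (\<Oplus>\<^bsub>M\<^esub>i\<in>I. c i \<odot>\<^bsub>M\<^esub> u i)"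
begin

definition coord :: "'m \<Rightarrow> 'i \<Rightarrow> 'r" where
  "coord x = (THE c. c \<in> I \<rightarrow>\<^sub>E carrier R \<and> x = (\<Oplus>\<^bsub>M\<^esub>i\<in>I. c i \<odot>\<^bsub>M\<^esub> u i))"

definition combination :: "('i \<Rightarrow> 'r) \<Rightarrow> 'm" where
  "combination c = (\<Oplus>\<^bsub>M\<^esub>i\<in>I. c i \<odot>\<^bsub>M\<^esub> u i)"

lemma combination_cong: "(\<And>i. i \<in> I \<Longrightarrow> c i \<in> carrier R) \<Longrightarrow> (\<And>i. i \<in> I \<Longrightarrow> c i = c' i) \<Longrightarrow>
    combination c = combination c'"
  unfolding combination_def
  by (intro M.add.finprod_cong') (auto simp: basis_closed smult_closed)

lemma combination_closed:
  "(\<And>i. i \<in> I \<Longrightarrow> c i \<in> carrier R) \<Longrightarrow> combination c \<in> carrier M"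
  unfolding combination_def by (intro M.finsum_closed) (auto simp: basis_closed smult_closed)

lemma combination_add:
  assumes "\<And>i. i \<in> I \<Longrightarrow> c i \<in> carrier R" "\<And>i. i \<in> I \<Longrightarrow> c' i \<in> carrier R"
  shows "combination (\<lambda>i. c i \<oplus>\<^bsub>R\<^esub> c' i) = combination c \<oplus>\<^bsub>M\<^esub> combination c'"
proof -
  have "combination (\<lambda>i. c i \<oplus>\<^bsub>R\<^esub> c' i)
      = (\<Oplus>\<^bsub>M\<^esub>i\<in>I. c i \<odot>\<^bsub>M\<^esub> u i \<oplus>\<^bsub>M\<^esub> c' i \<odot>\<^bsub>M\<^esub> u i)"
    unfolding combination_def
    by (intro M.add.finprod_cong') (auto simp: assms basis_closed smult_closed smult_l_distr)
  also have "\<dots> = combination c \<oplus>\<^bsub>M\<^esub> combination c'"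
    unfolding combination_def
    by (intro M.finsum_addf) (auto simp: assms basis_closed smult_closed)
  finally show ?thesis .
qed

lemma combination_smult:
  assumes "\<And>i. i \<in> I \<Longrightarrow> c i \<in> carrier R" "r \<in> carrier R"
  shows "combination (\<lambda>i. r \<otimes>\<^bsub>R\<^esub> c i) = r \<odot>\<^bsub>M\<^esub> combination c"
  unfolding combination_def
  by (subst smult_finsum)
     (auto intro!: M.add.finprod_cong' simp: finite_index assms basis_closed smult_closed smult_assoc)

lemma
  assumes "x \<in> carrier M"
  shows coord_closed: "\<And>i. i \<in> I \<Longrightarrow> coord x i \<in> carrier R"
    and combination_coord: "combination (coord x) = x"
  using theI'[OF ex1_coordinates[OF assms]] unfolding coord_def combination_def by auto

lemma coord_combination:
  assumes c: "\<And>i. i \<in> I \<Longrightarrow> c i \<in> carrier R" and i: "i \<in> I"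
  shows "coord (combination c) i = c i"
proof -
  have "combination (restrict c I) = combination c"
    using c by (intro combination_cong) auto
  then have "coord (combination c) = restrict c I"
    unfolding coord_def using c
    by (intro the1_equality ex1_coordinates combination_closed) (auto simp: combination_def)
  then show ?thesis using i by simp
qed

lemma coord_add:
  assumes "x \<in> carrier M" "y \<in> carrier M" "i \<in> I"
  shows "coord (x \<oplus>\<^bsub>M\<^esub> y) i = coord x i \<oplus>\<^bsub>R\<^esub> coord y i"
  using coord_combination[of "\<lambda>i. coord x i \<oplus>\<^bsub>R\<^esub> coord y i" i] assms
  by (simp add: combination_add combination_coord coord_closed)

lemma coord_smult:
  assumes "x \<in> carrier M" "r \<in> carrier R" "i \<in> I"
  shows "coord (r \<odot>\<^bsub>M\<^esub> x) i = r \<otimes>\<^bsub>R\<^esub> coord x i"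
  using coord_combination[of "\<lambda>i. r \<otimes>\<^bsub>R\<^esub> coord x i" i] assms
  by (simp add: combination_smult combination_coord coord_closed)

text \<open>
  Basis elements have unit vectors as coordinates. Over a nonzero ring these differ, so that a
  family of basis elements has no repetitions.
\<close>

lemma combination_unit:
  assumes "i \<in> I"
  shows "combination (\<lambda>j. if j = i then \<one>\<^bsub>R\<^esub> else \<zero>\<^bsub>R\<^esub>) = u i"
proof -
  have "combination (\<lambda>j. if j = i then \<one>\<^bsub>R\<^esub> else \<zero>\<^bsub>R\<^esub>)
      = (\<Oplus>\<^bsub>M\<^esub>j\<in>I. if i = j then u j else \<zero>\<^bsub>M\<^esub>)"
    unfolding combination_def
    by (intro M.add.finprod_cong') (auto simp: basis_closed smult_one smult_l_zero)
  also have "\<dots> = u i"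
    using assms finite_index basis_closed by (intro M.add.finprod_singleton) auto
  finally show ?thesis .
qed

lemma inj_on_basis:
  assumes "\<one>\<^bsub>R\<^esub> \<noteq> \<zero>\<^bsub>R\<^esub>"
  shows "inj_on u I"
proof (rule inj_onI)
  fix i j assume ij: "i \<in> I" "j \<in> I" "u i = u j"
  let ?unit = "\<lambda>i j. if j = i then \<one>\<^bsub>R\<^esub> else \<zero>\<^bsub>R\<^esub>"
  have "?unit i i = coord (combination (?unit i)) i"
    using ij by (subst coord_combination) auto
  also have "\<dots> = coord (combination (?unit j)) i"
    using ij by (simp only: combination_unit)
  also have "\<dots> = ?unit j i"
    using ij by (subst coord_combination) auto
  finally show "i = j" using assms by (auto split: if_splits)
qed

end

text \<open>
  A two-sided inverse \<open>\<kappa>\<close> of the formation of linear combinations replaces the unique existence of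
  extensional coordinate functions, which is awkward to establish each time.
\<close>

lemma based_moduleI:
  assumes "left_module R M" and "finite I"
    and u: "\<And>i. i \<in> I \<Longrightarrow> u i \<in> carrier M"
    and coord: "\<And>x i. x \<in> carrier M \<Longrightarrow> i \<in> I \<Longrightarrow> \<kappa> x i \<in> carrier R"
    and combination: "\<And>x. x \<in> carrier M \<Longrightarrow> (\<Oplus>\<^bsub>M\<^esub>i\<in>I. \<kappa> x i \<odot>\<^bsub>M\<^esub> u i) = x"
    and unique: "\<And>c i. (\<And>i. i \<in> I \<Longrightarrow> c i \<in> carrier R) \<Longrightarrow> i \<in> I \<Longrightarrow>
       \<kappa> (\<Oplus>\<^bsub>M\<^esub>i\<in>I. c i \<odot>\<^bsub>M\<^esub> u i) i = c i"
  shows "based_module R M I u"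
proof -
  interpret left_module R M by fact
  show ?thesis
  proof (intro based_module.intro based_module_axioms.intro left_module_axioms \<open>finite I\<close> u)
    fix x assume x: "x \<in> carrier M"
    have "(\<Oplus>\<^bsub>M\<^esub>i\<in>I. restrict (\<kappa> x) I i \<odot>\<^bsub>M\<^esub> u i) = (\<Oplus>\<^bsub>M\<^esub>i\<in>I. \<kappa> x i \<odot>\<^bsub>M\<^esub> u i)"
      using coord x u by (intro M.add.finprod_cong') (auto simp: smult_closed)
    then have sum: "(\<Oplus>\<^bsub>M\<^esub>i\<in>I. restrict (\<kappa> x) I i \<odot>\<^bsub>M\<^esub> u i) = x"
      using combination[OF x] by simp
    show "\<exists>!c. c \<in> I \<rightarrow>\<^sub>E carrier R \<and> x = (\<Oplus>\<^bsub>M\<^esub>i\<in>I. c i \<odot>\<^bsub>M\<^esub> u i)"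
    proof (intro ex1I[of _ "restrict (\<kappa> x) I"] conjI)
      show "restrict (\<kappa> x) I \<in> I \<rightarrow>\<^sub>E carrier R" using coord x by auto
      show "x = (\<Oplus>\<^bsub>M\<^esub>i\<in>I. restrict (\<kappa> x) I i \<odot>\<^bsub>M\<^esub> u i)" using sum by simp
      fix c assume c: "c \<in> I \<rightarrow>\<^sub>E carrier R \<and> x = (\<Oplus>\<^bsub>M\<^esub>i\<in>I. c i \<odot>\<^bsub>M\<^esub> u i)"
      show "c = restrict (\<kappa> x) I"
      proof (rule PiE_ext[of _ I])
        show "c \<in> I \<rightarrow>\<^sub>E carrier R" using c by simp
        show "restrict (\<kappa> x) I \<in> I \<rightarrow>\<^sub>E carrier R" using coord x by auto
        show "c i = restrict (\<kappa> x) I i" if "i \<in> I" for i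
        proof -
          have "\<kappa> (\<Oplus>\<^bsub>M\<^esub>i\<in>I. c i \<odot>\<^bsub>M\<^esub> u i) i = c i"
            using c that by (intro unique) auto
          then show ?thesis using c that by auto
        qed
      qed
    qed
  qed
qed

lemma (in based_module) based_module_reindex:
  assumes f: "bij_betw f J I" and v: "\<And>j. j \<in> J \<Longrightarrow> v j = u (f j)"
  shows "based_module R M J v"
proof (rule based_moduleI[where \<kappa> = "\<lambda>x j. coord x (f j)"])
  have fJ: "f j \<in> I" if "j \<in> J" for j using f that by (auto simp: bij_betw_def)
  show "left_module R M" by (rule left_module_axioms)
  show "finite J" using bij_betw_finite[OF f] finite_index by simp
  show "v j \<in> carrier M" if "j \<in> J" for j using that fJ v basis_closed by simp
  show "coord x (f j) \<in> carrier R" if "x \<in> carrier M" "j \<in> J" for x j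
    using that fJ coord_closed by simp
  have sum: "(\<Oplus>\<^bsub>M\<^esub>j\<in>J. c (f j) \<odot>\<^bsub>M\<^esub> v j) = combination c"
    if c: "\<And>i. i \<in> I \<Longrightarrow> c i \<in> carrier R" for c
  proof -
    have "(\<Oplus>\<^bsub>M\<^esub>j\<in>J. c (f j) \<odot>\<^bsub>M\<^esub> v j) = (\<Oplus>\<^bsub>M\<^esub>j\<in>J. c (f j) \<odot>\<^bsub>M\<^esub> u (f j))"
      using c fJ v basis_closed smult_closed by (intro M.add.finprod_cong') auto
    also have "\<dots> = (\<Oplus>\<^bsub>M\<^esub>i\<in>f ` J. c i \<odot>\<^bsub>M\<^esub> u i)"
      using f c fJ basis_closed smult_closed
      by (intro M.finsum_reindex[symmetric]) (auto simp: bij_betw_def)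
    finally show ?thesis using f by (simp add: bij_betw_def combination_def)
  qed
  show "(\<Oplus>\<^bsub>M\<^esub>j\<in>J. coord x (f j) \<odot>\<^bsub>M\<^esub> v j) = x" if "x \<in> carrier M" for x
    using sum[of "coord x"] that by (simp add: coord_closed combination_coord)
  show "coord (\<Oplus>\<^bsub>M\<^esub>j\<in>J. c j \<odot>\<^bsub>M\<^esub> v j) (f j) = c j"
    if c: "\<And>j. j \<in> J \<Longrightarrow> c j \<in> carrier R" and j: "j \<in> J" for c j
  proof -
    let ?g = "the_inv_into J f"
    have g: "?g i \<in> J" if "i \<in> I" for i
      using f that by (metis bij_betw_def the_inv_into_into order_refl)
    have gf: "?g (f j) = j" if "j \<in> J" for j
      using f that by (simp add: bij_betw_def the_inv_into_f_f)
    have "(\<Oplus>\<^bsub>M\<^esub>j\<in>J. c j \<odot>\<^bsub>M\<^esub> v j) = (\<Oplus>\<^bsub>M\<^esub>j\<in>J. c (?g (f j)) \<odot>\<^bsub>M\<^esub> v j)"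
      using c v fJ basis_closed gf smult_closed by (intro M.add.finprod_cong') auto
    then have "(\<Oplus>\<^bsub>M\<^esub>j\<in>J. c j \<odot>\<^bsub>M\<^esub> v j) = combination (\<lambda>i. c (?g i))"
      using sum[of "\<lambda>i. c (?g i)"] c g by simp
    then show ?thesis using coord_combination[of "\<lambda>i. c (?g i)" "f j"] c g gf fJ j by simp
  qed
qed

lemma module_basis_iff:
  assumes "left_module R M"
  shows "module_basis R M B \<longleftrightarrow> based_module R M B (\<lambda>b. b)"
  using assms by (simp add: module_basis_def based_module_def based_module_axioms_def subset_iff Ball_def)

lemma (in based_module) fg_free:
  assumes "\<one>\<^bsub>R\<^esub> \<noteq> \<zero>\<^bsub>R\<^esub>"
  shows "fg_free_left_module R M"
proof -
  have "bij_betw (inv_into I u) (u ` I) I"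
    using inj_on_basis[OF assms] by (simp add: inj_on_imp_bij_betw bij_betw_inv_into)
  then have "based_module R M (u ` I) (\<lambda>b. b)"
    by (rule based_module_reindex) (auto simp: f_inv_into_f)
  then show ?thesis
    unfolding fg_free_left_module_def using module_basis_iff left_module_axioms by blast
qed

lemma fg_free_left_moduleE:
  assumes "fg_free_left_module R M"
  obtains k :: nat and u where "based_module R M {..<k} u"
proof -
  from assms obtain B where "left_module R M" "module_basis R M B"
    by (auto simp: fg_free_left_module_def)
  then interpret based_module R M B "\<lambda>b. b" using module_basis_iff by blast
  obtain f where f: "bij_betw f {..<card B} B"
    using ex_bij_betw_nat_finite[OF finite_index] by (auto simp: atLeast0LessThan)
  show ?thesis using that based_module_reindex[OF f, of f] by simp
qed

section \<open>Free modules of functions\<close>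

text \<open>
  For finite \<open>P\<close> this is the free module with basis \<open>P\<close>. Functions of any index type serve, because
  the resolution below is assembled from blocks of indices.
\<close>

definition function_module :: "('r, 'c) ring_scheme \<Rightarrow> 'i set \<Rightarrow> ('r, 'i \<Rightarrow> 'r) module" where
  "function_module R P =
     \<lparr>carrier = {x. \<forall>p. if p \<in> P then x p \<in> carrier R else x p = \<zero>\<^bsub>R\<^esub>},
      monoid.mult = (\<lambda>x y. x), one = (\<lambda>p. \<zero>\<^bsub>R\<^esub>),
      ring.zero = (\<lambda>p. \<zero>\<^bsub>R\<^esub>),
      ring.add = (\<lambda>x y p. x p \<oplus>\<^bsub>R\<^esub> y p),
      smult = (\<lambda>a x p. a \<otimes>\<^bsub>R\<^esub> x p)\<rparr>"

lemma function_module_sel [simp]: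
  "\<zero>\<^bsub>function_module R P\<^esub> = (\<lambda>p. \<zero>\<^bsub>R\<^esub>)"
  "x \<oplus>\<^bsub>function_module R P\<^esub> y = (\<lambda>p. x p \<oplus>\<^bsub>R\<^esub> y p)"
  "a \<odot>\<^bsub>function_module R P\<^esub> x = (\<lambda>p. a \<otimes>\<^bsub>R\<^esub> x p)"
  by (simp_all add: function_module_def)

lemma function_module_carrier:
  "x \<in> carrier (function_module R P) \<longleftrightarrow>
     (\<forall>p\<in>P. x p \<in> carrier R) \<and> (\<forall>p. p \<notin> P \<longrightarrow> x p = \<zero>\<^bsub>R\<^esub>)"
  by (auto simp: function_module_def)

context ring
begin

lemma function_module_value_closed:
  "x \<in> carrier (function_module R P) \<Longrightarrow> x p \<in> carrier R"
  by (cases "p \<in> P") (auto simp: function_module_carrier)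

lemma left_module_function_module: "left_module R (function_module R P)"
proof (intro left_module.intro left_module_axioms.intro ring_axioms abelian_groupI)
  fix x assume x: "x \<in> carrier (function_module R P)"
  show "\<exists>y\<in>carrier (function_module R P).
      y \<oplus>\<^bsub>function_module R P\<^esub> x = \<zero>\<^bsub>function_module R P\<^esub>"
    using x by (intro bexI[of _ "\<lambda>p. \<ominus> x p"])
      (auto simp: function_module_carrier function_module_value_closed[OF x] l_neg)
qed (auto simp: function_module_carrier function_module_value_closed fun_eq_iff
      a_assoc m_assoc l_distr r_distr intro: a_comm)

lemma function_module_finsum:
  assumes "finite I" "f \<in> I \<rightarrow> carrier (function_module R P)"
  shows "(\<Oplus>\<^bsub>function_module R P\<^esub>i\<in>I. f i) p = (\<Oplus>i\<in>I. f i p)"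
proof -
  interpret F: left_module R "function_module R P" by (rule left_module_function_module)
  show ?thesis
    using hom_finsum[OF F.M.abelian_group_axioms abelian_group_axioms, of "\<lambda>x. x p" I f] assms
    by (auto simp: hom_def function_module_value_closed)
qed

lemma based_function_module:
  assumes "finite P"
  shows "based_module R (function_module R P) P (\<lambda>i p. if p = i then \<one> else \<zero>)"
    (is "based_module R ?F P ?u")
proof (rule based_moduleI[where \<kappa> = "\<lambda>x. x", OF left_module_function_module assms])
  have u: "?u i \<in> carrier ?F" if "i \<in> P" for i
    using that by (auto simp: function_module_carrier)
  show "?u i \<in> carrier ?F" if "i \<in> P" for i by (rule u[OF that])
  have sum: "(\<Oplus>\<^bsub>?F\<^esub>i\<in>P. c i \<odot>\<^bsub>?F\<^esub> ?u i) p = (if p \<in> P then c p else \<zero>)"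
    if c: "\<And>i. i \<in> P \<Longrightarrow> c i \<in> carrier R" for c p
  proof -
    have "(\<Oplus>\<^bsub>?F\<^esub>i\<in>P. c i \<odot>\<^bsub>?F\<^esub> ?u i) p = (\<Oplus>i\<in>P. c i \<otimes> (if p = i then \<one> else \<zero>))"
      using c by (subst function_module_finsum[OF assms]) (auto simp: function_module_carrier)
    also have "\<dots> = (\<Oplus>i\<in>P. if p = i then c i else \<zero>)"
      using c by (intro add.finprod_cong') auto
    also have "\<dots> = (if p \<in> P then c p else \<zero>)"
    proof (cases "p \<in> P")
      case True
      then show ?thesis using add.finprod_singleton[OF True assms, of c] c by auto
    next
      case False
      then have "(\<Oplus>i\<in>P. if p = i then c i else \<zero>) = (\<Oplus>i\<in>P. \<zero>)"
        by (intro add.finprod_cong') auto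
      then show ?thesis using False by (simp add: finsum_zero)
    qed
    finally show ?thesis .
  qed
  show "x p \<in> carrier R" if "x \<in> carrier ?F" "p \<in> P" for x p
    using that by (simp add: function_module_carrier)
  show "(\<Oplus>\<^bsub>?F\<^esub>i\<in>P. x i \<odot>\<^bsub>?F\<^esub> ?u i) = x" if "x \<in> carrier ?F" for x
    using that sum[of x] by (auto simp: function_module_carrier fun_eq_iff)
  show "(\<Oplus>\<^bsub>?F\<^esub>i\<in>P. c i \<odot>\<^bsub>?F\<^esub> ?u i) p = c p"
    if "\<And>i. i \<in> P \<Longrightarrow> c i \<in> carrier R" "p \<in> P" for c p
    using that sum[of c p] by auto
qed

end

section \<open>Partial free resolutions and the corner of a central idempotent\<close>

text \<open>
  The finiteness property for an arbitrary ring and an arbitrary module to be resolved: this is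
  what passes between a ring and its corner.
\<close>

definition partial_free_resolution ::
    "('r, 'c) ring_scheme \<Rightarrow> ('r, 'z, 'e) module_scheme \<Rightarrow> nat \<Rightarrow>
     (nat \<Rightarrow> ('r, 'm) module) \<Rightarrow> ('m \<Rightarrow> 'z) \<Rightarrow> (nat \<Rightarrow> 'm \<Rightarrow> 'm) \<Rightarrow> bool" where
  "partial_free_resolution R Z n A \<epsilon> d \<longleftrightarrow>
     (\<forall>i\<le>n. fg_free_left_module R (A i)) \<and>
     \<epsilon> \<in> left_module_hom R (A 0) Z \<and>
     (\<forall>i<n. d i \<in> left_module_hom R (A (Suc i)) (A i)) \<and>
     \<epsilon> ` carrier (A 0) = carrier Z \<and>
     (0 < n \<longrightarrow> d 0 ` carrier (A 1) = a_kernel (A 0) Z \<epsilon>) \<and>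
     (\<forall>i. Suc i < n \<longrightarrow> d (Suc i) ` carrier (A (Suc (Suc i))) = a_kernel (A (Suc i)) (A i) (d i))"

lemma left_module_homD:
  assumes "h \<in> left_module_hom R M N"
  shows "x \<in> carrier M \<Longrightarrow> h x \<in> carrier N"
    and "x \<in> carrier M \<Longrightarrow> y \<in> carrier M \<Longrightarrow> h (x \<oplus>\<^bsub>M\<^esub> y) = h x \<oplus>\<^bsub>N\<^esub> h y"
    and "a \<in> carrier R \<Longrightarrow> x \<in> carrier M \<Longrightarrow> h (a \<odot>\<^bsub>M\<^esub> x) = a \<odot>\<^bsub>N\<^esub> h x"
  using assms by (auto simp: left_module_hom_def hom_def)

lemma left_module_homI:
  assumes "\<And>x. x \<in> carrier M \<Longrightarrow> h x \<in> carrier N"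
    and "\<And>x y. x \<in> carrier M \<Longrightarrow> y \<in> carrier M \<Longrightarrow> h (x \<oplus>\<^bsub>M\<^esub> y) = h x \<oplus>\<^bsub>N\<^esub> h y"
    and "\<And>a x. a \<in> carrier R \<Longrightarrow> x \<in> carrier M \<Longrightarrow> h (a \<odot>\<^bsub>M\<^esub> x) = a \<odot>\<^bsub>N\<^esub> h x"
  shows "h \<in> left_module_hom R M N"
  using assms by (auto simp: left_module_hom_def hom_def)

text \<open>
  The idempotent is nonzero so that the corner is a nonzero ring, over which families that are bases
  have no repetitions.
\<close>

locale central_idempotent = ring R for R (structure) +
  fixes e
  assumes e_closed: "e \<in> carrier R"
    and e_idem: "e \<otimes> e = e"
    and e_central: "x \<in> carrier R \<Longrightarrow> e \<otimes> x = x \<otimes> e"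
    and e_nonzero: "e \<noteq> \<zero>"
begin

text \<open>
  As \<open>e\<close> is idempotent, \<open>e R\<close> and \<open>e M\<close> are the sets of fixed points of multiplication by \<open>e\<close>; in this
  form membership is an equation.
\<close>

definition corner_ring where
  "corner_ring = R\<lparr>carrier := {x \<in> carrier R. e \<otimes> x = x}, one := e\<rparr>"

definition corner_module :: "('a, 'm, 'd) module_scheme \<Rightarrow> ('a, 'm, 'd) module_scheme" where
  "corner_module M = M\<lparr>carrier := {x \<in> carrier M. e \<odot>\<^bsub>M\<^esub> x = x}\<rparr>"

lemma corner_ring_sel [simp]:
  "carrier corner_ring = {x \<in> carrier R. e \<otimes> x = x}"
  "\<one>\<^bsub>corner_ring\<^esub> = e"
  "\<zero>\<^bsub>corner_ring\<^esub> = \<zero>"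
  "x \<oplus>\<^bsub>corner_ring\<^esub> y = x \<oplus> y"
  "x \<otimes>\<^bsub>corner_ring\<^esub> y = x \<otimes> y"
  by (simp_all add: corner_ring_def)

lemma corner_module_sel [simp]:
  "carrier (corner_module M) = {x \<in> carrier M. e \<odot>\<^bsub>M\<^esub> x = x}"
  "\<zero>\<^bsub>corner_module M\<^esub> = \<zero>\<^bsub>M\<^esub>"
  "x \<oplus>\<^bsub>corner_module M\<^esub> y = x \<oplus>\<^bsub>M\<^esub> y"
  "a \<odot>\<^bsub>corner_module M\<^esub> x = a \<odot>\<^bsub>M\<^esub> x"
  by (simp_all add: corner_module_def)

lemma corner_module_eq:
  assumes "\<And>z. z \<in> carrier Z \<Longrightarrow> e \<odot>\<^bsub>Z\<^esub> z = z"
  shows "corner_module Z = Z"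
proof -
  have "{z \<in> carrier Z. e \<odot>\<^bsub>Z\<^esub> z = z} = carrier Z" using assms by auto
  then show ?thesis by (simp add: corner_module_def)
qed

lemma e_mult_left: "x \<in> carrier R \<Longrightarrow> e \<otimes> (e \<otimes> x) = e \<otimes> x"
  by (simp add: m_assoc[symmetric] e_closed e_idem)

lemma mult_e_right: "x \<in> carrier R \<Longrightarrow> e \<otimes> x = x \<Longrightarrow> x \<otimes> e = x"
  by (simp add: e_central)

lemma e_mult_mult_e: "x \<in> carrier R \<Longrightarrow> y \<in> carrier R \<Longrightarrow> (e \<otimes> x) \<otimes> (e \<otimes> y) = e \<otimes> (x \<otimes> y)"
  using e_closed e_mult_left by (metis e_central m_assoc m_closed)

lemma ring_corner_ring: "ring corner_ring"
proof (rule ringI)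
  show "abelian_group corner_ring"
  proof (rule abelian_groupI)
    show "\<exists>y\<in>carrier corner_ring. y \<oplus>\<^bsub>corner_ring\<^esub> x = \<zero>\<^bsub>corner_ring\<^esub>"
      if "x \<in> carrier corner_ring" for x
      using that by (intro bexI[of _ "\<ominus> x"]) (auto simp: l_neg r_minus e_closed)
  qed (auto simp: r_distr e_closed a_assoc intro: a_comm)
  show "Group.monoid corner_ring"
    by (rule monoidI) (auto simp: e_closed e_idem m_assoc[symmetric] mult_e_right)
qed (auto simp: l_distr r_distr)

lemma left_module_corner_module:
  assumes "left_module R M"
  shows "left_module corner_ring (corner_module M)"
proof -
  interpret M: left_module R M by fact
  show ?thesis
  proof (intro left_module.intro left_module_axioms.intro ring_corner_ring abelian_groupI)
    fix x assume x: "x \<in> carrier (corner_module M)"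
    have "e \<odot>\<^bsub>M\<^esub> (\<ominus>\<^bsub>M\<^esub> x) \<oplus>\<^bsub>M\<^esub> x = \<zero>\<^bsub>M\<^esub>"
      using x M.smult_r_distr[of e "\<ominus>\<^bsub>M\<^esub> x" x]
      by (simp add: e_closed M.M.l_neg M.smult_r_zero)
    then have "e \<odot>\<^bsub>M\<^esub> (\<ominus>\<^bsub>M\<^esub> x) = \<ominus>\<^bsub>M\<^esub> x"
      using x by (intro M.M.minus_equality[symmetric]) (auto simp: e_closed M.smult_closed)
    then show "\<exists>y\<in>carrier (corner_module M).
        y \<oplus>\<^bsub>corner_module M\<^esub> x = \<zero>\<^bsub>corner_module M\<^esub>"
      using x by (intro bexI[of _ "\<ominus>\<^bsub>M\<^esub> x"]) (auto simp: M.M.l_neg)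
  qed (auto simp: e_closed M.M.a_assoc M.smult_closed M.smult_r_distr M.smult_l_distr
      M.smult_r_zero M.smult_assoc[symmetric] intro: M.M.a_comm)
qed

lemma corner_module_finsum:
  assumes M: "left_module R M" and I: "finite I" and f: "f \<in> I \<rightarrow> carrier (corner_module M)"
  shows "(\<Oplus>\<^bsub>corner_module M\<^esub>i\<in>I. f i) = (\<Oplus>\<^bsub>M\<^esub>i\<in>I. f i)"
proof -
  interpret M: left_module R M by (rule M)
  interpret C: left_module corner_ring "corner_module M" by (rule left_module_corner_module[OF M])
  show ?thesis
    using hom_finsum[OF C.M.abelian_group_axioms M.M.abelian_group_axioms, of "\<lambda>x. x" I f] I f
    by (auto simp: hom_def)
qed

text \<open>
  If the \<open>u i\<close> form a basis of \<open>M\<close> over the ring, then the \<open>e u i\<close> form a basis of \<open>e M\<close> over the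
  corner, with the same coordinates: multiplication by \<open>e\<close> fixes \<open>x \<in> e M\<close>, hence its coordinates.
\<close>

lemma based_corner_module:
  assumes "based_module R M I u"
  shows "based_module corner_ring (corner_module M) I (\<lambda>i. e \<odot>\<^bsub>M\<^esub> u i)"
proof -
  interpret M: based_module R M I u by fact
  have eu: "e \<odot>\<^bsub>M\<^esub> u i \<in> carrier (corner_module M)" if "i \<in> I" for i
    using that by (simp add: M.basis_closed M.smult_closed e_closed e_idem M.smult_assoc[symmetric])
  have sum: "(\<Oplus>\<^bsub>corner_module M\<^esub>i\<in>I. c i \<odot>\<^bsub>corner_module M\<^esub> (e \<odot>\<^bsub>M\<^esub> u i)) = M.combination c"
    if c: "\<And>i. i \<in> I \<Longrightarrow> c i \<in> carrier corner_ring" for c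
  proof -
    have ce: "c i \<odot>\<^bsub>M\<^esub> (e \<odot>\<^bsub>M\<^esub> u i) = c i \<odot>\<^bsub>M\<^esub> u i" if "i \<in> I" for i
      using that c[OF that] by (simp add: M.basis_closed e_closed M.smult_assoc[symmetric] mult_e_right)
    have "e \<odot>\<^bsub>M\<^esub> (c i \<odot>\<^bsub>M\<^esub> u i) = c i \<odot>\<^bsub>M\<^esub> u i" if "i \<in> I" for i
      using that c[OF that] by (simp add: M.basis_closed e_closed M.smult_assoc[symmetric])
    then have "(\<Oplus>\<^bsub>corner_module M\<^esub>i\<in>I. c i \<odot>\<^bsub>corner_module M\<^esub> (e \<odot>\<^bsub>M\<^esub> u i))
        = (\<Oplus>\<^bsub>M\<^esub>i\<in>I. c i \<odot>\<^bsub>M\<^esub> (e \<odot>\<^bsub>M\<^esub> u i))"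
      using c by (subst corner_module_finsum)
        (auto simp: M.left_module_axioms M.finite_index ce M.basis_closed M.smult_closed)
    also have "\<dots> = M.combination c"
      unfolding M.combination_def using c
      by (intro M.M.add.finprod_cong') (auto simp: ce M.basis_closed M.smult_closed)
    finally show ?thesis .
  qed
  have coord: "M.coord x i \<in> carrier corner_ring" if "x \<in> carrier (corner_module M)" "i \<in> I" for x i
    using that M.coord_smult[of x e i] by (simp add: M.coord_closed e_closed)
  show ?thesis
  proof (rule based_moduleI[where \<kappa> = M.coord])
    show "(\<Oplus>\<^bsub>corner_module M\<^esub>i\<in>I. M.coord x i \<odot>\<^bsub>corner_module M\<^esub> (e \<odot>\<^bsub>M\<^esub> u i)) = x"
      if "x \<in> carrier (corner_module M)" for x
      using that coord by (subst sum) (auto simp: M.combination_coord)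
    show "M.coord (\<Oplus>\<^bsub>corner_module M\<^esub>i\<in>I. c i \<odot>\<^bsub>corner_module M\<^esub> (e \<odot>\<^bsub>M\<^esub> u i)) i = c i"
      if "\<And>i. i \<in> I \<Longrightarrow> c i \<in> carrier corner_ring" "i \<in> I" for c i
      using that by (subst sum) (auto simp: M.coord_combination)
    show "left_module corner_ring (corner_module M)" "finite I"
      by (simp_all add: left_module_corner_module M.left_module_axioms M.finite_index)
  qed (fact eu coord)+
qed

lemma fg_free_corner_module:
  assumes "fg_free_left_module R M"
  shows "fg_free_left_module corner_ring (corner_module M)"
proof -
  obtain k :: nat and u where "based_module R M {..<k} u"
    using fg_free_left_moduleE[OF assms] .
  then interpret based_module corner_ring "corner_module M" "{..<k}" "\<lambda>i. e \<odot>\<^bsub>M\<^esub> u i"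
    by (rule based_corner_module)
  show ?thesis by (rule fg_free) (simp add: e_nonzero)
qed

lemma corner_module_hom:
  assumes h: "h \<in> left_module_hom R M N"
  shows "h \<in> left_module_hom corner_ring (corner_module M) (corner_module N)"
proof (rule left_module_homI)
  show "h x \<in> carrier (corner_module N)" if "x \<in> carrier (corner_module M)" for x
    using that left_module_homD(1)[OF h, of x] left_module_homD(3)[OF h, of e x]
    by (simp add: e_closed)
qed (simp_all add: left_module_homD[OF h])

text \<open>
  If \<open>y = h x\<close> is fixed by \<open>e\<close>, then \<open>y = h (e x)\<close>. Kernels commute with the passage to \<open>e M\<close> for the
  trivial reason that they are sets of solutions.
\<close>

lemma corner_module_image:
  assumes M: "left_module R M" and h: "h \<in> left_module_hom R M N"
  shows "h ` carrier (corner_module M) = {y \<in> h ` carrier M. e \<odot>\<^bsub>N\<^esub> y = y}"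
proof (intro equalityI subsetI)
  interpret M: left_module R M by fact
  fix y assume "y \<in> {y \<in> h ` carrier M. e \<odot>\<^bsub>N\<^esub> y = y}"
  then obtain x where x: "x \<in> carrier M" "y = h x" "e \<odot>\<^bsub>N\<^esub> h x = h x" by auto
  have "y = h (e \<odot>\<^bsub>M\<^esub> x)" using x by (simp add: left_module_homD(3)[OF h] e_closed)
  moreover have "e \<odot>\<^bsub>M\<^esub> x \<in> carrier (corner_module M)"
    using x by (simp add: M.smult_closed e_closed e_idem M.smult_assoc[symmetric])
  ultimately show "y \<in> h ` carrier (corner_module M)" by blast
next
  fix y assume "y \<in> h ` carrier (corner_module M)"
  then obtain x where x: "x \<in> carrier M" "e \<odot>\<^bsub>M\<^esub> x = x" "y = h x" by auto
  then have "e \<odot>\<^bsub>N\<^esub> y = y" using left_module_homD(3)[OF h, of e x] by (simp add: e_closed)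
  then show "y \<in> {y \<in> h ` carrier M. e \<odot>\<^bsub>N\<^esub> y = y}" using x by auto
qed

lemma corner_module_kernel:
  "a_kernel (corner_module M) (corner_module N) h = {x \<in> a_kernel M N h. e \<odot>\<^bsub>M\<^esub> x = x}"
  by (auto simp: a_kernel_def')

text \<open>
  Multiplication by \<open>e\<close> is a natural projection of every module \<open>M\<close> onto its direct summand \<open>e M\<close>,
  so that \<open>M \<mapsto> e M\<close> is exact.
\<close>

lemma partial_free_resolution_corner_module:
  assumes res: "partial_free_resolution R Z n A \<epsilon> d"
  shows "partial_free_resolution corner_ring (corner_module Z) n (\<lambda>i. corner_module (A i)) \<epsilon> d"
proof -
  have A: "fg_free_left_module R (A i)" "left_module R (A i)" if "i \<le> n" for i
    using res that by (auto simp: partial_free_resolution_def fg_free_left_module_def)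
  have \<epsilon>: "\<epsilon> \<in> left_module_hom R (A 0) Z" "\<epsilon> ` carrier (A 0) = carrier Z"
    using res by (auto simp: partial_free_resolution_def)
  have d: "d i \<in> left_module_hom R (A (Suc i)) (A i)" if "i < n" for i
    using res that by (auto simp: partial_free_resolution_def)
  have d0: "d 0 ` carrier (A 1) = a_kernel (A 0) Z \<epsilon>" if "0 < n"
    using res that by (auto simp: partial_free_resolution_def)
  have dS: "d (Suc i) ` carrier (A (Suc (Suc i))) = a_kernel (A (Suc i)) (A i) (d i)" if "Suc i < n" for i
    using res that by (auto simp: partial_free_resolution_def)
  show ?thesis
    unfolding partial_free_resolution_def
  proof (intro conjI allI impI)
    show "\<epsilon> ` carrier (corner_module (A 0)) = carrier (corner_module Z)"
      using \<epsilon> by (subst corner_module_image[OF A(2) \<epsilon>(1)]) auto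
    show "d 0 ` carrier (corner_module (A 1)) = a_kernel (corner_module (A 0)) (corner_module Z) \<epsilon>"
      if "0 < n"
      using corner_module_image[OF A(2)[of "Suc 0"] d[OF that]] that d0
      by (simp add: corner_module_kernel)
    show "d (Suc i) ` carrier (corner_module (A (Suc (Suc i))))
        = a_kernel (corner_module (A (Suc i))) (corner_module (A i)) (d i)" if "Suc i < n" for i
      using corner_module_image[OF A(2)[of "Suc (Suc i)"] d[OF that]] that dS[OF that]
      by (simp add: corner_module_kernel)
  qed (simp_all add: fg_free_corner_module A corner_module_hom \<epsilon> d)
qed

end

section \<open>From the corner to the ring\<close>

text \<open>
  Let \<open>M\<close> be free over the corner \<open>e R\<close> with basis \<open>b\<close>. Then \<open>M\<close> is isomorphic to \<open>e R\<^sup>I\<close>, a direct summand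
  of \<open>R\<^sup>I\<close>; the maps \<open>assemble\<close> and \<open>spread\<close> below are the projection of \<open>R\<^sup>I\<close> onto \<open>M\<close> and the inclusion
  of \<open>M\<close> into \<open>R\<^sup>I\<close>. Both are \<open>R\<close>-linear if \<open>r \<in> R\<close> acts on \<open>M\<close> as \<open>e r\<close>.
\<close>

locale corner_based = central_idempotent R e + M: based_module corner_ring M I b
  for R :: "('a, 'b) ring_scheme" (structure) and e
    and M :: "('a, 'm, 'd) module_scheme" and I :: "'i set" and b :: "'i \<Rightarrow> 'm"
begin

definition assemble :: "('i \<Rightarrow> 'a) \<Rightarrow> 'm" where
  "assemble x = M.combination (\<lambda>i. e \<otimes> x i)"

definition spread :: "'m \<Rightarrow> 'i \<Rightarrow> 'a" where
  "spread a i = (if i \<in> I then M.coord a i else \<zero>)"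

lemma assemble_closed: "(\<And>i. i \<in> I \<Longrightarrow> x i \<in> carrier R) \<Longrightarrow> assemble x \<in> carrier M"
  unfolding assemble_def by (rule M.combination_closed) (simp add: e_closed e_mult_left)

lemma assemble_cong:
  assumes "\<And>i. i \<in> I \<Longrightarrow> x i \<in> carrier R" "\<And>i. i \<in> I \<Longrightarrow> x i = y i"
  shows "assemble x = assemble y"
  unfolding assemble_def using assms by (intro M.combination_cong) (auto simp: e_closed e_mult_left)

lemma assemble_add:
  assumes "\<And>i. i \<in> I \<Longrightarrow> x i \<in> carrier R" "\<And>i. i \<in> I \<Longrightarrow> y i \<in> carrier R"
  shows "assemble (\<lambda>i. x i \<oplus> y i) = assemble x \<oplus>\<^bsub>M\<^esub> assemble y"
proof -
  have "assemble (\<lambda>i. x i \<oplus> y i) = M.combination (\<lambda>i. e \<otimes> x i \<oplus> e \<otimes> y i)"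
    unfolding assemble_def using assms
    by (intro M.combination_cong) (auto simp: e_closed e_mult_left r_distr)
  then show ?thesis
    unfolding assemble_def using M.combination_add[of "\<lambda>i. e \<otimes> x i" "\<lambda>i. e \<otimes> y i"] assms
    by (simp add: e_closed e_mult_left)
qed

lemma assemble_smult:
  assumes "\<And>i. i \<in> I \<Longrightarrow> x i \<in> carrier R" "r \<in> carrier R"
  shows "assemble (\<lambda>i. r \<otimes> x i) = (e \<otimes> r) \<odot>\<^bsub>M\<^esub> assemble x"
proof -
  have "e \<otimes> (r \<otimes> x i) = (e \<otimes> r) \<otimes> (e \<otimes> x i)" if "i \<in> I" for i
    using assms that by (simp add: e_mult_mult_e)
  moreover have "e \<otimes> (r \<otimes> x i) \<in> carrier corner_ring" if "i \<in> I" for i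
    using assms that by (simp add: e_closed e_mult_left)
  ultimately have "assemble (\<lambda>i. r \<otimes> x i) = M.combination (\<lambda>i. (e \<otimes> r) \<otimes> (e \<otimes> x i))"
    unfolding assemble_def by (intro M.combination_cong)
  then show ?thesis
    unfolding assemble_def using M.combination_smult[of "\<lambda>i. e \<otimes> x i" "e \<otimes> r"] assms
    by (simp add: e_closed e_mult_left)
qed

lemma spread_closed: "a \<in> carrier M \<Longrightarrow> spread a i \<in> carrier R"
  using M.coord_closed[of a i] by (simp add: spread_def)

lemma e_spread: "a \<in> carrier M \<Longrightarrow> e \<otimes> spread a i = spread a i"
  using M.coord_closed[of a i] by (simp add: spread_def e_closed)

lemma spread_outside: "i \<notin> I \<Longrightarrow> spread a i = \<zero>"
  by (simp add: spread_def)

lemma assemble_spread: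
  assumes "a \<in> carrier M"
  shows "assemble (spread a) = a"
proof -
  have "assemble (spread a) = M.combination (M.coord a)"
    unfolding assemble_def using M.coord_closed[OF assms]
    by (intro M.combination_cong) (auto simp: spread_def)
  then show ?thesis using assms by (simp add: M.combination_coord)
qed

lemma spread_assemble:
  "(\<And>i. i \<in> I \<Longrightarrow> x i \<in> carrier R) \<Longrightarrow> i \<in> I \<Longrightarrow> spread (assemble x) i = e \<otimes> x i"
  unfolding spread_def assemble_def
  by (simp add: M.coord_combination e_closed e_mult_left)

lemma spread_add:
  "x \<in> carrier M \<Longrightarrow> y \<in> carrier M \<Longrightarrow> spread (x \<oplus>\<^bsub>M\<^esub> y) i = spread x i \<oplus> spread y i"
  by (simp add: spread_def M.coord_add)

lemma spread_smult:
  assumes "x \<in> carrier M" "r \<in> carrier R"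
  shows "spread ((e \<otimes> r) \<odot>\<^bsub>M\<^esub> x) i = r \<otimes> spread x i"
proof (cases "i \<in> I")
  case True
  then have "spread ((e \<otimes> r) \<odot>\<^bsub>M\<^esub> x) i = (e \<otimes> r) \<otimes> spread x i"
    using assms by (simp add: spread_def M.coord_smult e_closed e_mult_left)
  also have "\<dots> = (r \<otimes> e) \<otimes> spread x i"
    using assms by (simp add: e_central)
  also have "\<dots> = r \<otimes> spread x i"
    using assms by (simp add: e_closed m_assoc spread_closed e_spread)
  finally show ?thesis .
qed (simp add: spread_def assms)

lemma spread_zero: "spread \<zero>\<^bsub>M\<^esub> i = \<zero>"
  using spread_smult[of "\<zero>\<^bsub>M\<^esub>" \<zero> i] by (simp add: e_closed M.smult_r_zero spread_closed)

lemma spread_eq_zero_imp: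
  assumes "a \<in> carrier M" "\<And>i. i \<in> I \<Longrightarrow> spread a i = \<zero>"
  shows "a = \<zero>\<^bsub>M\<^esub>"
proof -
  have "assemble (spread a) = assemble (spread \<zero>\<^bsub>M\<^esub>)"
    using assms by (intro assemble_cong) (auto simp: spread_zero)
  then show ?thesis using assms by (simp add: assemble_spread)
qed

end

text \<open>
  Given a resolution \<open>A\<close> over the corner, where \<open>A i\<close> has a basis indexed by \<open>I i\<close>, the module \<open>F i\<close> over \<open>R\<close>
  is free on the disjoint union of \<open>I 0, \<dots>, I i\<close>. Its top block \<open>R\<^bsup>I i\<^esup>\<close> is the sum of a copy of \<open>A i\<close>
  and a complement; the lower blocks serve to kill the complements of lower degrees. The boundary
  map from \<open>F (i + 1)\<close> to \<open>F i\<close> consists of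

  \<^item> the given map \<open>\<delta> i\<close> from the summand \<open>A (i + 1)\<close> of the top block to the summand \<open>A i\<close> of block \<open>i\<close>;

  \<^item> on each block \<open>j \<le> i\<close>, multiplication by \<open>1 - e\<close> if \<open>i - j\<close> is even and by \<open>e\<close> if it is odd.

  On block \<open>i\<close> the second part covers the complement of \<open>A i\<close>. On a fixed block \<open>j\<close> the sequence
  \<open>\<dots>, 1 - e, e, 1 - e\<close> is exact, because \<open>e\<close> and \<open>1 - e\<close> are complementary idempotents. The function
  \<open>level\<close> returns the block of an index.
\<close>

locale corner_resolution = central_idempotent R e + Z: left_module R Z
  for R :: "('a, 'b) ring_scheme" (structure) and e and Z :: "('a, 'z, 'd) module_scheme" +
  fixes n :: nat and A :: "nat \<Rightarrow> ('a, 'm) module" and \<epsilon> :: "'m \<Rightarrow> 'z"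
    and \<delta> :: "nat \<Rightarrow> 'm \<Rightarrow> 'm"
    and I :: "nat \<Rightarrow> 'i set" and b :: "nat \<Rightarrow> 'i \<Rightarrow> 'm" and level :: "'i \<Rightarrow> nat"
  assumes e_trivial: "z \<in> carrier Z \<Longrightarrow> e \<odot>\<^bsub>Z\<^esub> z = z"
    and resolution: "partial_free_resolution corner_ring Z n A \<epsilon> \<delta>"
    and based: "i \<le> n \<Longrightarrow> based_module corner_ring (A i) (I i) (b i)"
    and level: "p \<in> I i \<Longrightarrow> level p = i"
begin

lemma corner_based: "i \<le> n \<Longrightarrow> corner_based R e (A i) (I i) (b i)"
  by (intro corner_based.intro central_idempotent_axioms based)

abbreviation \<phi> where "\<phi> i \<equiv> corner_based.assemble R e (A i) (I i) (b i)"
abbreviation \<psi> where "\<psi> i \<equiv> corner_based.spread R e (A i) (I i) (b i)"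

definition support :: "nat \<Rightarrow> 'i set" where
  "support i = (\<Union>j\<le>i. I j)"

abbreviation F :: "nat \<Rightarrow> ('a, 'i \<Rightarrow> 'a) module" where
  "F i \<equiv> function_module R (support i)"

definition switch :: "nat \<Rightarrow> nat \<Rightarrow> 'a" where
  "switch i j = (if even (i + j) then \<one> \<ominus> e else e)"

definition boundary :: "nat \<Rightarrow> ('i \<Rightarrow> 'a) \<Rightarrow> 'i \<Rightarrow> 'a" where
  "boundary i x p = (if p \<in> support i
     then switch i (level p) \<otimes> x p \<oplus> \<psi> i (\<delta> i (\<phi> (Suc i) x)) p else \<zero>)"

lemma switch_closed: "switch i j \<in> carrier R"
  by (simp add: switch_def e_closed)

lemma switch_central: "x \<in> carrier R \<Longrightarrow> switch i j \<otimes> x = x \<otimes> switch i j"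
  by (simp add: switch_def e_closed e_central minus_eq l_distr r_distr l_minus r_minus)

lemma switch_self: "switch i i = \<one> \<ominus> e"
  by (simp add: switch_def)

lemma switch_orthogonal: "switch i j \<otimes> switch (Suc i) j = \<zero>"
  by (simp add: switch_def e_closed e_idem minus_eq l_distr r_distr l_minus r_minus r_neg)

lemma switch_complement:
  assumes "x \<in> carrier R"
  shows "switch i j \<otimes> x \<oplus> switch (Suc i) j \<otimes> x = x"
proof -
  have "switch i j \<oplus> switch (Suc i) j = \<one>"
    by (simp add: switch_def e_closed minus_eq a_assoc l_neg a_comm[of e])
  then show ?thesis
    using assms by (simp add: l_distr[symmetric] switch_closed)
qed

lemma e_complement: "x \<in> carrier R \<Longrightarrow> e \<otimes> ((\<one> \<ominus> e) \<otimes> x) = \<zero>"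
  by (simp add: m_assoc[symmetric] e_closed e_idem minus_eq r_distr r_minus r_neg)

lemma complement_plus: "x \<in> carrier R \<Longrightarrow> (\<one> \<ominus> e) \<otimes> x \<oplus> e \<otimes> x = x"
  by (simp add: l_distr[symmetric] e_closed minus_eq a_assoc l_neg)

lemma support_mono: "I i \<subseteq> support i" "support i \<subseteq> support (Suc i)" "I (Suc i) \<subseteq> support (Suc i)"
  by (auto simp: support_def intro: le_SucI)

lemma support_cases:
  "p \<in> support (Suc i) \<Longrightarrow> p \<in> support i \<or> p \<in> I (Suc i)"
  by (auto simp: support_def le_Suc_eq)

lemma level_support: "p \<in> support i \<Longrightarrow> level p \<le> i"
  by (auto simp: support_def dest: level)

lemma support_disjoint: "p \<in> support i \<Longrightarrow> p \<notin> I (Suc i)"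
  using level level_support by fastforce

lemma finite_support: "i \<le> n \<Longrightarrow> finite (support i)"
  using based by (auto simp: support_def based_module_def based_module_axioms_def)

lemma fg_free_F: "i \<le> n \<Longrightarrow> fg_free_left_module R (F i)"
proof -
  assume "i \<le> n"
  then interpret based_module R "F i" "support i" "\<lambda>i p. if p = i then \<one> else \<zero>"
    by (intro based_function_module finite_support)
  show ?thesis
    using e_nonzero e_closed by (intro fg_free) (metis l_one l_null)
qed

lemma
  shows \<epsilon>_hom: "\<epsilon> \<in> left_module_hom corner_ring (A 0) Z"
    and \<epsilon>_surj: "\<epsilon> ` carrier (A 0) = carrier Z"
    and \<delta>_hom: "i < n \<Longrightarrow> \<delta> i \<in> left_module_hom corner_ring (A (Suc i)) (A i)"
    and \<delta>_exact_0: "0 < n \<Longrightarrow> \<delta> 0 ` carrier (A 1) = a_kernel (A 0) Z \<epsilon>"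
    and \<delta>_exact: "Suc i < n \<Longrightarrow>
      \<delta> (Suc i) ` carrier (A (Suc (Suc i))) = a_kernel (A (Suc i)) (A i) (\<delta> i)"
  using resolution by (simp_all add: partial_free_resolution_def)

lemma value_closed: "x \<in> carrier (F i) \<Longrightarrow> x p \<in> carrier R"
  by (rule function_module_value_closed)

lemma \<phi>_closed: "i \<le> n \<Longrightarrow> x \<in> carrier (F j) \<Longrightarrow> \<phi> i x \<in> carrier (A i)"
  by (intro corner_based.assemble_closed corner_based value_closed)

lemma \<delta>_\<phi>_closed: "i < n \<Longrightarrow> x \<in> carrier (F j) \<Longrightarrow> \<delta> i (\<phi> (Suc i) x) \<in> carrier (A i)"
  by (intro left_module_homD(1)[OF \<delta>_hom] \<phi>_closed) auto

lemma \<psi>_closed: "i \<le> n \<Longrightarrow> a \<in> carrier (A i) \<Longrightarrow> \<psi> i a p \<in> carrier R"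
  by (intro corner_based.spread_closed corner_based)

lemma \<phi>_add:
  assumes "i \<le> n" "x \<in> carrier (F i)" "y \<in> carrier (F i)"
  shows "\<phi> i (x \<oplus>\<^bsub>F i\<^esub> y) = \<phi> i x \<oplus>\<^bsub>A i\<^esub> \<phi> i y"
  using assms corner_based.assemble_add[OF corner_based[of i], of x y] by (simp add: value_closed)

lemma \<phi>_smult:
  assumes "i \<le> n" "x \<in> carrier (F i)" "r \<in> carrier R"
  shows "\<phi> i (r \<odot>\<^bsub>F i\<^esub> x) = (e \<otimes> r) \<odot>\<^bsub>A i\<^esub> \<phi> i x"
  using assms corner_based.assemble_smult[OF corner_based[of i], of x r] by (simp add: value_closed)

lemma e_mult_closed: "r \<in> carrier R \<Longrightarrow> e \<otimes> r \<in> carrier corner_ring"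
  by (simp add: e_closed e_mult_left)

lemma boundary_hom:
  assumes i: "i < n"
  shows "boundary i \<in> left_module_hom R (F (Suc i)) (F i)"
proof (rule left_module_homI)
  note closed = switch_closed \<psi>_closed[of i] \<delta>_\<phi>_closed
  fix x assume x: "x \<in> carrier (F (Suc i))"
  show "boundary i x \<in> carrier (F i)"
    using i x by (auto simp: function_module_carrier[of "boundary i x"] boundary_def
        switch_closed value_closed[OF x] \<psi>_closed \<delta>_\<phi>_closed[OF _ x])
  {
    fix y assume y: "y \<in> carrier (F (Suc i))"
    have eq: "\<psi> i (\<delta> i (\<phi> (Suc i) (x \<oplus>\<^bsub>F (Suc i)\<^esub> y))) p
        = \<psi> i (\<delta> i (\<phi> (Suc i) x)) p \<oplus> \<psi> i (\<delta> i (\<phi> (Suc i) y)) p" for p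
      using i x y
      by (simp only: \<phi>_add Suc_leI left_module_homD(2)[OF \<delta>_hom] \<phi>_closed \<delta>_\<phi>_closed
          corner_based.spread_add[OF corner_based] less_imp_le)
    have "boundary i (x \<oplus>\<^bsub>F (Suc i)\<^esub> y) p = boundary i x p \<oplus> boundary i y p" for p
    proof (cases "p \<in> support i")
      case True
      then show ?thesis
        unfolding boundary_def eq using i x y
        by (simp add: closed value_closed[OF x] value_closed[OF y] r_distr a_ac)
    qed (simp add: boundary_def)
    then show "boundary i (x \<oplus>\<^bsub>F (Suc i)\<^esub> y) = boundary i x \<oplus>\<^bsub>F i\<^esub> boundary i y"
      by (simp add: fun_eq_iff)
  }
  fix r assume r: "r \<in> carrier R"
  have eq: "\<psi> i (\<delta> i (\<phi> (Suc i) (r \<odot>\<^bsub>F (Suc i)\<^esub> x))) p = r \<otimes> \<psi> i (\<delta> i (\<phi> (Suc i) x)) p" for p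
    using i x r
    by (simp only: \<phi>_smult Suc_leI left_module_homD(3)[OF \<delta>_hom e_mult_closed] \<phi>_closed \<delta>_\<phi>_closed
        corner_based.spread_smult[OF corner_based] less_imp_le)
  have "boundary i (r \<odot>\<^bsub>F (Suc i)\<^esub> x) p = r \<otimes> boundary i x p" for p
  proof (cases "p \<in> support i")
    case True
    have "switch i j \<otimes> (r \<otimes> x p) = r \<otimes> (switch i j \<otimes> x p)" for j
      using r value_closed[OF x]
      by (simp add: m_assoc[symmetric] switch_closed switch_central[of r])
    then show ?thesis
      unfolding boundary_def eq using i x r True
      by (simp add: closed value_closed[OF x] r_distr)
  qed (simp add: boundary_def r)
  then show "boundary i (r \<odot>\<^bsub>F (Suc i)\<^esub> x) = r \<odot>\<^bsub>F i\<^esub> boundary i x"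
    by (simp add: fun_eq_iff)
qed

lemma augmentation_hom: "(\<lambda>x. \<epsilon> (\<phi> 0 x)) \<in> left_module_hom R (F 0) Z"
proof (rule left_module_homI)
  fix x assume x: "x \<in> carrier (F 0)"
  then show "\<epsilon> (\<phi> 0 x) \<in> carrier Z"
    by (intro left_module_homD(1)[OF \<epsilon>_hom] \<phi>_closed) auto
  show "\<epsilon> (\<phi> 0 (x \<oplus>\<^bsub>F 0\<^esub> y)) = \<epsilon> (\<phi> 0 x) \<oplus>\<^bsub>Z\<^esub> \<epsilon> (\<phi> 0 y)" if y: "y \<in> carrier (F 0)" for y
    using x y by (simp only: \<phi>_add le0 left_module_homD(2)[OF \<epsilon>_hom] \<phi>_closed)
  show "\<epsilon> (\<phi> 0 (r \<odot>\<^bsub>F 0\<^esub> x)) = r \<odot>\<^bsub>Z\<^esub> \<epsilon> (\<phi> 0 x)" if r: "r \<in> carrier R" for r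
  proof -
    have closed: "\<epsilon> (\<phi> 0 x) \<in> carrier Z"
      using x by (intro left_module_homD(1)[OF \<epsilon>_hom] \<phi>_closed) auto
    have "\<epsilon> (\<phi> 0 (r \<odot>\<^bsub>F 0\<^esub> x)) = (e \<otimes> r) \<odot>\<^bsub>Z\<^esub> \<epsilon> (\<phi> 0 x)"
      using x r by (simp only: \<phi>_smult le0 left_module_homD(3)[OF \<epsilon>_hom e_mult_closed] \<phi>_closed)
    also have "\<dots> = r \<odot>\<^bsub>Z\<^esub> \<epsilon> (\<phi> 0 x)"
      using closed r by (simp add: Z.smult_assoc Z.smult_closed e_closed e_trivial)
    finally show ?thesis .
  qed
qed

text \<open>
  The projections onto the \<open>A i\<close> form a chain map: the part of the boundary with \<open>1 - e\<close> is killed by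
  the projection.
\<close>

lemma \<phi>_boundary:
  assumes i: "i < n" and x: "x \<in> carrier (F (Suc i))"
  shows "\<phi> i (boundary i x) = \<delta> i (\<phi> (Suc i) x)"
proof -
  interpret B: corner_based R e "A i" "I i" "b i" using i by (intro corner_based) simp
  let ?a = "\<delta> i (\<phi> (Suc i) x)"
  have a: "?a \<in> carrier (A i)" by (rule \<delta>_\<phi>_closed[OF i x])
  have "\<phi> i (boundary i x) = \<phi> i (\<lambda>p. (\<one> \<ominus> e) \<otimes> x p \<oplus> \<psi> i ?a p)"
  proof (rule B.assemble_cong)
    fix p assume "p \<in> I i"
    then show "boundary i x p = (\<one> \<ominus> e) \<otimes> x p \<oplus> \<psi> i ?a p"
      using support_mono(1) level switch_self by (auto simp: boundary_def)
    then show "boundary i x p \<in> carrier R"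
      by (simp add: value_closed[OF x] e_closed B.spread_closed a)
  qed
  also have "\<dots> = \<phi> i (\<lambda>p. (\<one> \<ominus> e) \<otimes> x p) \<oplus>\<^bsub>A i\<^esub> \<phi> i (\<psi> i ?a)"
    by (intro B.assemble_add) (simp_all add: value_closed[OF x] e_closed B.spread_closed a)
  also have "\<phi> i (\<lambda>p. (\<one> \<ominus> e) \<otimes> x p) = (e \<otimes> (\<one> \<ominus> e)) \<odot>\<^bsub>A i\<^esub> \<phi> i x"
    by (intro B.assemble_smult) (simp_all add: value_closed[OF x] e_closed)
  also have "e \<otimes> (\<one> \<ominus> e) = \<zero>"
    using e_complement[of \<one>] by (simp add: e_closed)
  also have "\<zero> \<odot>\<^bsub>A i\<^esub> \<phi> i x = \<zero>\<^bsub>A i\<^esub>"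
    using B.M.smult_l_zero[of "\<phi> i x"] B.assemble_closed[of x] value_closed[OF x] by simp
  finally show ?thesis using a by (simp add: B.assemble_spread)
qed

text \<open>
  On block \<open>i\<close> the two summands of the boundary lie in \<open>(1 - e) R\<close> and in \<open>e R\<close>, so that both vanish if
  their sum does; on the other blocks only the first summand is present.
\<close>

lemma boundary_eq_zero_imp:
  assumes i: "i < n" and x: "x \<in> carrier (F (Suc i))" and zero: "boundary i x = (\<lambda>p. \<zero>)"
  shows "\<delta> i (\<phi> (Suc i) x) = \<zero>\<^bsub>A i\<^esub>"
    and "p \<in> support i \<Longrightarrow> switch i (level p) \<otimes> x p = \<zero>"
proof -
  interpret B: corner_based R e "A i" "I i" "b i" using i by (intro corner_based) simp
  let ?a = "\<delta> i (\<phi> (Suc i) x)"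
  have a: "?a \<in> carrier (A i)" by (rule \<delta>_\<phi>_closed[OF i x])
  have eq: "switch i (level p) \<otimes> x p \<oplus> \<psi> i ?a p = \<zero>" if "p \<in> support i" for p
    using fun_cong[OF zero, of p] that by (simp add: boundary_def)
  have \<psi>_zero: "\<psi> i ?a p = \<zero>" if p: "p \<in> I i" for p
  proof -
    have "p \<in> support i" using p support_mono(1) by blast
    then have "\<zero> = e \<otimes> ((\<one> \<ominus> e) \<otimes> x p \<oplus> \<psi> i ?a p)"
      using eq[of p] by (simp add: level[OF p] switch_self e_closed)
    also have "\<dots> = e \<otimes> ((\<one> \<ominus> e) \<otimes> x p) \<oplus> e \<otimes> \<psi> i ?a p"
      by (intro r_distr) (simp_all add: e_closed value_closed[OF x] B.spread_closed a)
    also have "\<dots> = \<psi> i ?a p"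
      using a by (simp add: e_complement value_closed[OF x] B.e_spread B.spread_closed)
    finally show ?thesis by simp
  qed
  then show a0: "?a = \<zero>\<^bsub>A i\<^esub>" using a by (intro B.spread_eq_zero_imp)
  show "switch i (level p) \<otimes> x p = \<zero>" if "p \<in> support i"
    using eq[OF that] value_closed[OF x] by (simp add: a0 B.spread_zero switch_closed)
qed

text \<open>
  The source of exactness: the preimage of \<open>y\<close> has the same entries as \<open>y\<close> on the blocks up to \<open>i\<close>, and
  a preimage of the image of \<open>y\<close> in \<open>A i\<close> on the top block. On block \<open>i\<close> its boundary is
  \<open>(1 - e) y + e y = y\<close>.
\<close>

lemma boundary_lift:
  assumes i: "i < n" and y: "y \<in> carrier (F i)"
    and a: "a \<in> carrier (A (Suc i))" "\<delta> i a = \<phi> i y"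
    and lower: "\<And>p. p \<in> support i \<Longrightarrow> p \<notin> I i \<Longrightarrow> switch i (level p) \<otimes> y p = y p"
  shows "y \<in> boundary i ` carrier (F (Suc i))"
proof -
  interpret B: corner_based R e "A i" "I i" "b i" using i by (intro corner_based) simp
  interpret C: corner_based R e "A (Suc i)" "I (Suc i)" "b (Suc i)" using i by (intro corner_based) simp
  define x where "x p = (if p \<in> support i then y p else \<psi> (Suc i) a p)" for p
  have x_closed: "x p \<in> carrier R" for p
    by (simp add: x_def value_closed[OF y] C.spread_closed a)
  have x: "x \<in> carrier (F (Suc i))"
    unfolding function_module_carrier
  proof (intro conjI ballI allI impI x_closed)
    fix p assume "p \<notin> support (Suc i)"
    then have "p \<notin> support i" "p \<notin> I (Suc i)"
      using support_mono(2,3)[of i] by blast+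
    then show "x p = \<zero>" by (simp add: x_def C.spread_outside)
  qed
  have "\<phi> (Suc i) x = \<phi> (Suc i) (\<psi> (Suc i) a)"
    by (intro C.assemble_cong x_closed) (auto simp: x_def dest: support_disjoint)
  then have \<delta>\<phi>: "\<delta> i (\<phi> (Suc i) x) = \<phi> i y" using a by (simp add: C.assemble_spread)
  have "boundary i x p = y p" for p
  proof (cases "p \<in> support i")
    case True
    then have boundary: "boundary i x p = switch i (level p) \<otimes> y p \<oplus> \<psi> i (\<phi> i y) p"
      by (simp add: boundary_def \<delta>\<phi>) (simp add: x_def)
    show ?thesis
    proof (cases "p \<in> I i")
      case True
      then show ?thesis
        using boundary by (simp add: level switch_self B.spread_assemble value_closed[OF y] complement_plus)
    next
      case False
      then show ?thesis
        using boundary lower[OF \<open>p \<in> support i\<close>] by (simp add: B.spread_outside value_closed[OF y])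
    qed
  next
    case False
    then show ?thesis using y by (simp add: boundary_def function_module_carrier)
  qed
  then show ?thesis using x by (intro image_eqI[of _ _ x]) auto
qed

lemma boundary_exact_0:
  assumes n: "0 < n"
  shows "boundary 0 ` carrier (F 1) = a_kernel (F 0) Z (\<lambda>x. \<epsilon> (\<phi> 0 x))"
proof (intro equalityI subsetI)
  fix y assume "y \<in> boundary 0 ` carrier (F 1)"
  then obtain x where x: "x \<in> carrier (F (Suc 0))" "y = boundary 0 x" by auto
  have "\<delta> 0 (\<phi> (Suc 0) x) \<in> \<delta> 0 ` carrier (A 1)"
    using \<phi>_closed[of "Suc 0" x "Suc 0"] n x by auto
  then have "\<epsilon> (\<delta> 0 (\<phi> (Suc 0) x)) = \<zero>\<^bsub>Z\<^esub>"
    unfolding \<delta>_exact_0[OF n] by (simp add: a_kernel_def')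
  then show "y \<in> a_kernel (F 0) Z (\<lambda>x. \<epsilon> (\<phi> 0 x))"
    using x n left_module_homD(1)[OF boundary_hom[OF n]]
    by (simp add: a_kernel_def' \<phi>_boundary)
next
  fix y assume "y \<in> a_kernel (F 0) Z (\<lambda>x. \<epsilon> (\<phi> 0 x))"
  then have y: "y \<in> carrier (F 0)" "\<epsilon> (\<phi> 0 y) = \<zero>\<^bsub>Z\<^esub>" by (auto simp: a_kernel_def')
  then have "\<phi> 0 y \<in> a_kernel (A 0) Z \<epsilon>" by (simp add: a_kernel_def' \<phi>_closed[where j = 0])
  then obtain a where "a \<in> carrier (A (Suc 0))" "\<delta> 0 a = \<phi> 0 y"
    using \<delta>_exact_0[OF n] by (metis One_nat_def imageE)
  then show "y \<in> boundary 0 ` carrier (F 1)"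
    using boundary_lift[OF n y(1)] by (auto simp: support_def)
qed

lemma boundary_exact:
  assumes n: "Suc i < n"
  shows "boundary (Suc i) ` carrier (F (Suc (Suc i))) = a_kernel (F (Suc i)) (F i) (boundary i)"
proof (intro equalityI subsetI)
  fix y assume "y \<in> boundary (Suc i) ` carrier (F (Suc (Suc i)))"
  then obtain x where x: "x \<in> carrier (F (Suc (Suc i)))" and y_def: "y = boundary (Suc i) x" by auto
  have y: "y \<in> carrier (F (Suc i))"
    using left_module_homD(1)[OF boundary_hom[OF n] x] y_def by simp
  interpret B: corner_based R e "A i" "I i" "b i" using n by (intro corner_based) simp
  interpret C: corner_based R e "A (Suc i)" "I (Suc i)" "b (Suc i)" using n by (intro corner_based) simp
  have "\<phi> (Suc i) y \<in> \<delta> (Suc i) ` carrier (A (Suc (Suc i)))"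
    using n x \<phi>_closed[OF Suc_leI[OF n] x] by (auto simp: y_def \<phi>_boundary)
  then have \<delta>y: "\<delta> i (\<phi> (Suc i) y) = \<zero>\<^bsub>A i\<^esub>"
    using n by (auto simp: \<delta>_exact a_kernel_def')
  have "boundary i y p = \<zero>" for p
  proof (cases "p \<in> support i")
    case True
    then have "p \<in> support (Suc i)" "p \<notin> I (Suc i)"
      using support_mono(2) support_disjoint by auto
    then have "y p = switch (Suc i) (level p) \<otimes> x p"
      by (simp add: y_def boundary_def C.spread_outside switch_closed value_closed[OF x])
    then show ?thesis
      by (simp add: boundary_def \<delta>y B.spread_zero m_assoc[symmetric] switch_closed
          value_closed[OF x] switch_orthogonal)
  qed (simp add: boundary_def)
  then show "y \<in> a_kernel (F (Suc i)) (F i) (boundary i)"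
    using y by (simp add: a_kernel_def' fun_eq_iff)
next
  fix y assume "y \<in> a_kernel (F (Suc i)) (F i) (boundary i)"
  then have y: "y \<in> carrier (F (Suc i))" and zero: "boundary i y = (\<lambda>p. \<zero>)"
    by (auto simp: a_kernel_def')
  have i: "i < n" using n by simp
  have "\<phi> (Suc i) y \<in> a_kernel (A (Suc i)) (A i) (\<delta> i)"
    using boundary_eq_zero_imp(1)[OF i y zero] n y
    by (simp add: a_kernel_def' \<phi>_closed[where j = "Suc i"])
  then obtain a where a: "a \<in> carrier (A (Suc (Suc i)))" "\<delta> (Suc i) a = \<phi> (Suc i) y"
    using \<delta>_exact[OF n] by (metis imageE)
  show "y \<in> boundary (Suc i) ` carrier (F (Suc (Suc i)))"
  proof (rule boundary_lift[OF n y a])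
    fix p assume "p \<in> support (Suc i)" "p \<notin> I (Suc i)"
    then have "p \<in> support i" using support_cases by blast
    then have "switch i (level p) \<otimes> y p = \<zero>" by (rule boundary_eq_zero_imp(2)[OF i y zero])
    then show "switch (Suc i) (level p) \<otimes> y p = y p"
      using switch_complement[of "y p" i "level p"] by (simp add: value_closed[OF y] switch_closed)
  qed
qed

lemma partial_free_resolution_F: "partial_free_resolution R Z n F (\<lambda>x. \<epsilon> (\<phi> 0 x)) boundary"
  unfolding partial_free_resolution_def
proof (intro conjI allI impI)
  interpret B: corner_based R e "A 0" "I 0" "b 0" by (intro corner_based) simp
  show "(\<lambda>x. \<epsilon> (\<phi> 0 x)) ` carrier (F 0) = carrier Z"
  proof (intro equalityI subsetI)
    fix z assume "z \<in> carrier Z"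
    then obtain a where a: "a \<in> carrier (A 0)" "z = \<epsilon> a" using \<epsilon>_surj by auto
    have "\<psi> 0 a \<in> carrier (F 0)"
      using a by (simp add: function_module_carrier support_def B.spread_closed B.spread_outside)
    then show "z \<in> (\<lambda>x. \<epsilon> (\<phi> 0 x)) ` carrier (F 0)"
      using a by (intro image_eqI[of _ _ "\<psi> 0 a"]) (simp_all add: B.assemble_spread)
  qed (use left_module_homD(1)[OF augmentation_hom] in auto)
qed (simp_all add: fg_free_F augmentation_hom boundary_hom boundary_exact boundary_exact_0[simplified])

end

theorem (in central_idempotent) partial_free_resolution_from_corner:
  fixes Z :: "('a, 'z, 'd) module_scheme" and A :: "nat \<Rightarrow> ('a, 'm) module"
  assumes Z: "left_module R Z" and e_trivial: "\<And>z. z \<in> carrier Z \<Longrightarrow> e \<odot>\<^bsub>Z\<^esub> z = z"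
    and res: "partial_free_resolution corner_ring Z n A \<epsilon> \<delta>"
  obtains A' :: "nat \<Rightarrow> ('a, nat \<Rightarrow> 'a) module" and \<epsilon>' d'
  where "partial_free_resolution R Z n A' \<epsilon>' d'"
proof -
  \<comment> \<open>The pairing function makes the blocks disjoint sets of natural numbers, whatever their sizes.\<close>
  have "\<exists>k u. based_module corner_ring (A i) {..<k :: nat} u" if "i \<le> n" for i
    using res that fg_free_left_moduleE by (metis partial_free_resolution_def)
  then obtain k u where ku: "\<And>i. i \<le> n \<Longrightarrow> based_module corner_ring (A i) {..<k i :: nat} (u i)"
    by metis
  define I where "I i = (\<lambda>q. prod_encode (i, q)) ` {..<k i}" for i
  have "based_module corner_ring (A i) (I i) (\<lambda>p. u i (snd (prod_decode p)))" if "i \<le> n" for i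
  proof (rule based_module.based_module_reindex[OF ku[OF that]])
    show "bij_betw (\<lambda>p. snd (prod_decode p)) (I i) {..<k i}"
      by (rule bij_betw_byWitness[where f' = "\<lambda>q. prod_encode (i, q)"]) (auto simp: I_def)
  qed simp
  then interpret corner_resolution R e Z n A \<epsilon> \<delta> I "\<lambda>i p. u i (snd (prod_decode p))"
      "\<lambda>p. fst (prod_decode p)"
    using e_trivial res
    by (intro corner_resolution.intro corner_resolution_axioms.intro Z central_idempotent_axioms)
      (auto simp: I_def)
  show thesis using that partial_free_resolution_F .
qed

section \<open>Minimal idempotents of Clifford monoids\<close>

lemma left_FP_iff:
  "left_FP n S \<longleftrightarrow> (\<exists>A \<epsilon> d. partial_free_resolution (monoid_ring S)
     (trivial_module :: ('a \<Rightarrow>\<^sub>0 int, int) module) n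
     (A :: nat \<Rightarrow> ('a \<Rightarrow>\<^sub>0 int, nat \<Rightarrow> 'a \<Rightarrow>\<^sub>0 int) module) \<epsilon> d)"
  for S :: "('a, 'b) monoid_scheme"
  unfolding left_FP_def partial_free_resolution_def by (rule refl)

lemma finsum_trivial_module: "finite I \<Longrightarrow> finsum trivial_module f I = sum f I"
proof (induction I rule: finite_induct)
  have "abelian_group trivial_module"
    by (rule abelian_groupI) (auto intro: exI[of _ "- _"])
  then interpret abelian_group trivial_module .
  case empty
  show ?case using finsum_empty by simp
  case (insert i I)
  then show ?case using finsum_insert[of I i f] by simp
qed

context clifford_monoid
begin

lemma idempotentD: "f \<in> idempotents S \<Longrightarrow> f \<in> carrier S" "f \<in> idempotents S \<Longrightarrow> f \<otimes> f = f"
  by (auto simp: idempotents_def)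

lemma idempotents_mult:
  assumes "f \<in> idempotents S" "g \<in> idempotents S"
  shows "f \<otimes> g \<in> idempotents S"
proof -
  have "(f \<otimes> g) \<otimes> (f \<otimes> g) = f \<otimes> (g \<otimes> f) \<otimes> g"
    using assms by (simp add: idempotentD m_assoc)
  also have "g \<otimes> f = f \<otimes> g" using assms idempotentD idempotents_central by simp
  also have "f \<otimes> (f \<otimes> g) \<otimes> g = (f \<otimes> f) \<otimes> (g \<otimes> g)"
    using assms idempotentD(1) by (simp add: m_assoc)
  finally show ?thesis using assms by (simp add: idempotents_def)
qed

lemma support_idempotent:
  assumes "x \<in> carrier S"
  obtains y where "y \<in> carrier S" "x \<otimes> y \<in> idempotents S" "y \<otimes> x \<in> idempotents S" "x \<otimes> y \<otimes> x = x"
proof -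
  obtain y where y: "y \<in> carrier S" "x \<otimes> y \<otimes> x = x" using regular[OF assms] by auto
  have "(x \<otimes> y) \<otimes> (x \<otimes> y) = x \<otimes> y \<otimes> x \<otimes> y" "(y \<otimes> x) \<otimes> (y \<otimes> x) = y \<otimes> (x \<otimes> y \<otimes> x)"
    using assms y(1) by (simp_all add: m_assoc)
  then show thesis using that[of y] y assms by (simp add: idempotents_def)
qed

text \<open>
  Idempotents form a meet semilattice, in which a minimal element is the least element.
\<close>

lemma minimal_idempotent_absorbs:
  assumes e: "minimal_idempotent S e" and g: "g \<in> idempotents S"
  shows "e \<otimes> g = e"
proof -
  have e': "e \<in> idempotents S" using e by (simp add: minimal_idempotent_def)
  have eg: "e \<otimes> g \<in> idempotents S" using e' g by (rule idempotents_mult)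
  have "e \<otimes> g \<otimes> e = e \<otimes> (e \<otimes> g)"
    using idempotents_central[OF e', of "e \<otimes> g"] eg idempotentD by simp
  also have "\<dots> = e \<otimes> g"
    using e' g by (simp add: m_assoc[symmetric] idempotentD)
  finally have "natural_le S (e \<otimes> g) e"
    using idempotents_central[OF e', of "e \<otimes> g"] eg idempotentD by (simp add: natural_le_def)
  then show ?thesis using e eg by (simp add: minimal_idempotent_def)
qed

text \<open>
  The indicator function of the \<open>x\<close> of which \<open>f\<close> is a multiple. In terms of the idempotent \<open>x y\<close> that
  regularity attaches to \<open>x\<close>, the condition says that \<open>f \<le> x y\<close>. It therefore holds for a product
  exactly if it holds for both factors.
\<close>

definition filter_character :: "'a \<Rightarrow> 'a \<Rightarrow> int" where
  "filter_character f x = (if \<exists>v\<in>carrier S. x \<otimes> v \<otimes> f = f then 1 else 0)"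

lemma filter_character_mult:
  assumes f: "f \<in> idempotents S" and x: "x \<in> carrier S" and y: "y \<in> carrier S"
  shows "filter_character f (x \<otimes> y) = filter_character f x * filter_character f y"
proof -
  note f' = idempotentD(1)[OF f]
  have "(\<exists>v\<in>carrier S. x \<otimes> y \<otimes> v \<otimes> f = f) \<longleftrightarrow>
      (\<exists>v\<in>carrier S. x \<otimes> v \<otimes> f = f) \<and> (\<exists>v\<in>carrier S. y \<otimes> v \<otimes> f = f)" (is "?xy \<longleftrightarrow> ?x \<and> ?y")
  proof (intro iffI conjI)
    assume ?xy
    then obtain v where v: "v \<in> carrier S" "x \<otimes> y \<otimes> v \<otimes> f = f" by auto
    then show ?x using x y by (intro bexI[of _ "y \<otimes> v"]) (simp_all add: m_assoc f')
    obtain z where z: "z \<in> carrier S" "y \<otimes> z \<in> idempotents S" "y \<otimes> z \<otimes> y = y"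
      using support_idempotent[OF y] .
    have "y \<otimes> z \<otimes> f = y \<otimes> z \<otimes> (x \<otimes> (y \<otimes> v \<otimes> f))"
      using v x y f' by (simp add: m_assoc)
    also have "\<dots> = (y \<otimes> z \<otimes> x) \<otimes> (y \<otimes> v \<otimes> f)"
      using v x y z f' by (simp add: m_assoc)
    also have "y \<otimes> z \<otimes> x = x \<otimes> (y \<otimes> z)" using idempotents_central[OF z(2) x] .
    also have "x \<otimes> (y \<otimes> z) \<otimes> (y \<otimes> v \<otimes> f) = x \<otimes> (y \<otimes> z \<otimes> y) \<otimes> v \<otimes> f"
      using v(1) x y z(1) f' by (simp add: m_assoc)
    also have "\<dots> = f" using z v by simp
    finally show ?y using z by auto
  next
    assume "?x \<and> ?y"
    then obtain v w where v: "v \<in> carrier S" "x \<otimes> v \<otimes> f = f" and w: "w \<in> carrier S" "y \<otimes> w \<otimes> f = f"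
      by auto
    have "x \<otimes> y \<otimes> (w \<otimes> v) \<otimes> f = x \<otimes> (y \<otimes> w \<otimes> (v \<otimes> f))"
      using v(1) w(1) x y f' by (simp add: m_assoc)
    also have "v \<otimes> f = f \<otimes> v" using idempotents_central[OF f v(1)] by simp
    also have "x \<otimes> (y \<otimes> w \<otimes> (f \<otimes> v)) = x \<otimes> (y \<otimes> w \<otimes> f \<otimes> v)"
      using v(1) w(1) x y f' by (simp add: m_assoc)
    also have "\<dots> = x \<otimes> (v \<otimes> f)" using w idempotents_central[OF f v(1)] by simp
    also have "\<dots> = f" using v x f' by (simp add: m_assoc)
    finally show ?xy using v w by auto
  qed
  then show ?thesis by (auto simp: filter_character_def)
qed

lemma filter_character_one:
  assumes "f \<in> idempotents S"
  shows "filter_character f \<one> = 1"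
  using idempotentD(1)[OF assms] unfolding filter_character_def by (auto intro!: bexI[of _ \<one>])

text \<open>
  The product of the idempotents attached to the members of \<open>F\<close> lies below each of them.
\<close>

lemma filter_character_finite:
  assumes "finite F" "F \<subseteq> carrier S"
  shows "\<exists>f\<in>idempotents S. \<forall>x\<in>F. filter_character f x = 1"
  using assms
proof (induction F rule: finite_induct)
  case empty
  show ?case by (intro bexI[of _ \<one>]) (auto simp: idempotents_def)
next
  case (insert x F)
  then obtain f where f: "f \<in> idempotents S" "\<And>y. y \<in> F \<Longrightarrow> filter_character f y = 1" by auto
  have x: "x \<in> carrier S" using insert by simp
  obtain x' where x': "x' \<in> carrier S" "x \<otimes> x' \<in> idempotents S" using support_idempotent[OF x] .
  define g where "g = x \<otimes> x' \<otimes> f"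
  have g: "g \<in> idempotents S" unfolding g_def by (rule idempotents_mult[OF x'(2) f(1)])
  have "x \<otimes> x' \<otimes> g = (x \<otimes> x') \<otimes> (x \<otimes> x') \<otimes> f"
    using x x' f idempotentD(1) by (simp add: g_def m_assoc)
  then have gx: "x \<otimes> x' \<otimes> g = g"
    using idempotentD(2)[OF x'(2)] by (simp add: g_def)
  have gf: "f \<otimes> g = g"
  proof -
    have "f \<otimes> g = g \<otimes> f" using idempotents_central[OF f(1)] g idempotentD by simp
    also have "\<dots> = x \<otimes> x' \<otimes> (f \<otimes> f)"
      using x x' f idempotentD(1) by (simp add: g_def m_assoc)
    finally show ?thesis using f by (simp add: g_def idempotentD)
  qed
  have "filter_character g y = 1" if y: "y \<in> F" for y
  proof -
    have yS: "y \<in> carrier S" using insert.prems y by auto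
    obtain v where v: "v \<in> carrier S" "y \<otimes> v \<otimes> f = f"
      using f(2)[OF y] by (auto simp: filter_character_def split: if_splits)
    have "y \<otimes> v \<otimes> g = (y \<otimes> v \<otimes> f) \<otimes> g"
      using yS v(1) f(1) g idempotentD(1) by (simp add: m_assoc gf)
    also have "\<dots> = g" using v gf by simp
    finally show ?thesis using v by (auto simp: filter_character_def)
  qed
  moreover have "filter_character g x = 1"
    using gx x' by (auto simp: filter_character_def)
  ultimately show ?case using g by auto
qed

lemma minimal_idempotentI:
  assumes f: "f \<in> idempotents S" and char: "\<And>g. g \<in> idempotents S \<Longrightarrow> filter_character f g = 1"
  shows "minimal_idempotent S f"
  unfolding minimal_idempotent_def
proof (intro conjI ballI impI f)
  fix g assume g: "g \<in> idempotents S" and le: "natural_le S g f"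
  obtain v where v: "v \<in> carrier S" "g \<otimes> v \<otimes> f = f"
    using char[OF g] by (auto simp: filter_character_def split: if_splits)
  have "g \<otimes> f = (g \<otimes> g) \<otimes> v \<otimes> f"
    using v f g idempotentD(1) by (metis m_assoc m_closed)
  also have "\<dots> = f" using v g by (simp add: idempotentD)
  finally show "g = f" using le by (simp add: natural_le_def)
qed

text \<open>
  Let \<open>d 0\<close> map \<open>A 1\<close> onto the kernel of \<open>\<epsilon>\<close>, let \<open>\<epsilon> x = 1\<close>, and let \<open>F\<close> be the finite set of all elements
  of \<open>S\<close> that occur in the coordinates of \<open>x\<close> and of the images of the basis elements of \<open>A 1\<close>. Take
  \<open>f\<close> with \<open>\<chi> = 1\<close> on \<open>F\<close>, where \<open>\<chi>\<close> is the character of \<open>f\<close>. As \<open>A 0\<close> is free, there is a \<open>\<chi>\<close>-linear map \<open>h\<close>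
  to \<open>\<int>\<close> that agrees with \<open>\<epsilon>\<close> on the basis of \<open>A 0\<close>. It agrees with \<open>\<epsilon>\<close> on all elements whose
  coordinates only involve \<open>F\<close>; so \<open>h x = 1\<close>, and \<open>h\<close> vanishes on generators of the kernel of \<open>\<epsilon>\<close>, hence
  on the kernel. For an idempotent \<open>g\<close> the element \<open>(g - 1) x\<close> is in the kernel, so \<open>\<chi> g = 1\<close>.
\<close>

lemma left_FP_imp_minimal_idempotent:
  assumes FP: "left_FP n S" and n: "n \<ge> 1"
  shows "\<exists>e. minimal_idempotent S e"
proof -
  let ?Z = "trivial_module :: ('a \<Rightarrow>\<^sub>0 int, int) module" and ?R = "monoid_ring S"
  interpret Z: left_module ?R ?Z
    by (rule trivial_module_is_left_module) (rule monoid_axioms)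
  obtain A :: "nat \<Rightarrow> ('a \<Rightarrow>\<^sub>0 int, nat \<Rightarrow> 'a \<Rightarrow>\<^sub>0 int) module" and \<epsilon> d
    where "partial_free_resolution ?R ?Z n A \<epsilon> d"
    using FP unfolding left_FP_iff by blast
  then have A: "fg_free_left_module ?R (A 0)" "fg_free_left_module ?R (A (Suc 0))"
    and \<epsilon>: "\<epsilon> \<in> left_module_hom ?R (A 0) ?Z" "\<epsilon> ` carrier (A 0) = carrier ?Z"
    and d: "d 0 \<in> left_module_hom ?R (A (Suc 0)) (A 0)" "d 0 ` carrier (A (Suc 0)) = a_kernel (A 0) ?Z \<epsilon>"
    using n by (auto simp: partial_free_resolution_def)
  obtain k :: nat and u where "based_module ?R (A 0) {..<k} u"
    using fg_free_left_moduleE[OF A(1)] .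
  then interpret A0: based_module ?R "A 0" "{..<k}" u .
  obtain m :: nat and w where "based_module ?R (A (Suc 0)) {..<m} w"
    using fg_free_left_moduleE[OF A(2)] .
  then interpret A1: based_module ?R "A (Suc 0)" "{..<m}" w .
  obtain x where x: "x \<in> carrier (A 0)" "\<epsilon> x = 1"
    using \<epsilon>(2) by (metis UNIV_I imageE trivial_module_sel(1))
  have d_closed: "d 0 a \<in> carrier (A 0)" if "a \<in> carrier (A (Suc 0))" for a
    by (rule left_module_homD(1)[OF d(1) that])
  define F where "F = (\<Union>i<k. \<Union>y\<in>insert x ((\<lambda>j. d 0 (w j)) ` {..<m}). Poly_Mapping.keys (A0.coord y i))"
  have generators: "y \<in> carrier (A 0)" if "y \<in> insert x ((\<lambda>j. d 0 (w j)) ` {..<m})" for y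
    using that
  proof (elim insertE imageE)
    fix j assume "y = d 0 (w j)" "j \<in> {..<m}"
    then show ?thesis using d_closed[OF A1.basis_closed] by blast
  qed (use x in blast)
  have "finite F" by (simp add: F_def)
  moreover have "F \<subseteq> carrier S"
    unfolding F_def
  proof (intro UN_least)
    fix i y assume "i \<in> {..<k}" and y: "y \<in> insert x ((\<lambda>j. d 0 (w j)) ` {..<m})"
    then have "A0.coord y i \<in> carrier ?R"
      by (intro A0.coord_closed[OF generators[OF y]])
    then show "Poly_Mapping.keys (A0.coord y i) \<subseteq> carrier S" by simp
  qed
  ultimately obtain f where f: "f \<in> idempotents S" and fF: "\<And>s. s \<in> F \<Longrightarrow> filter_character f s = 1"
    using filter_character_finite[of F] by meson
  let ?\<chi> = "linear_extension (filter_character f)"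
  have \<chi>_mult: "?\<chi> (p \<otimes>\<^bsub>?R\<^esub> q) = ?\<chi> p * ?\<chi> q" if "p \<in> carrier ?R" "q \<in> carrier ?R" for p q
    using that by (intro linear_extension_mult filter_character_mult[OF f]) auto
  define h where "h y = (\<Sum>i<k. ?\<chi> (A0.coord y i) * \<epsilon> (u i))" for y
  have h_add: "h (y \<oplus>\<^bsub>A 0\<^esub> z) = h y + h z" if "y \<in> carrier (A 0)" "z \<in> carrier (A 0)" for y z
    using that by (simp add: h_def A0.coord_add distrib_right sum.distrib)
  have h_smult: "h (r \<odot>\<^bsub>A 0\<^esub> y) = ?\<chi> r * h y" if "y \<in> carrier (A 0)" "r \<in> carrier ?R" for r y
    unfolding h_def sum_distrib_left
    by (intro sum.cong refl)
      (simp only: that A0.coord_smult \<chi>_mult A0.coord_closed mult.assoc)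
  have h_eq: "h y = \<epsilon> y" if y: "y \<in> insert x ((\<lambda>j. d 0 (w j)) ` {..<m})" for y
  proof -
    have "?\<chi> (A0.coord y i) = augmentation (A0.coord y i)" if "i < k" for i
      using that y by (intro linear_extension_eq_augmentation fF) (auto simp: F_def)
    then have "h y = (\<Sum>i<k. \<epsilon> (A0.coord y i \<odot>\<^bsub>A 0\<^esub> u i))"
      unfolding h_def using A0.coord_closed[OF generators[OF y]] A0.basis_closed
      by (intro sum.cong refl) (simp add: left_module_homD(3)[OF \<epsilon>(1)])
    also have "\<dots> = \<epsilon> (A0.combination (A0.coord y))"
      unfolding A0.combination_def using \<epsilon>(1) A0.coord_closed[OF generators[OF y]] A0.basis_closed
      by (subst hom_finsum[OF A0.M.abelian_group_axioms Z.M.abelian_group_axioms])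
        (auto simp: left_module_hom_def finsum_trivial_module intro!: A0.smult_closed)
    finally show ?thesis using generators[OF y] by (simp add: A0.combination_coord)
  qed
  have h_d: "h (d 0 a) = 0" if a: "a \<in> carrier (A (Suc 0))" for a
  proof -
    have hd: "(\<lambda>a. h (d 0 a)) \<in> hom (add_monoid (A (Suc 0))) (add_monoid ?Z)"
      by (auto simp: hom_def left_module_homD(2)[OF d(1)] h_add d_closed)
    have "h (d 0 a) = h (d 0 (A1.combination (A1.coord a)))"
      by (simp only: A1.combination_coord[OF a])
    also have "\<dots> = (\<Sum>j<m. h (d 0 (A1.coord a j \<odot>\<^bsub>A (Suc 0)\<^esub> w j)))"
      unfolding A1.combination_def using A1.coord_closed[OF a] A1.basis_closed
      by (subst hom_finsum[OF A1.M.abelian_group_axioms Z.M.abelian_group_axioms hd])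
        (auto simp: finsum_trivial_module intro!: A1.smult_closed)
    also have "\<dots> = (\<Sum>j<m. 0)"
    proof (intro sum.cong refl)
      fix j assume j: "j \<in> {..<m}"
      have "d 0 (w j) \<in> a_kernel (A 0) ?Z \<epsilon>"
        using j d(2) A1.basis_closed by blast
      then have "h (d 0 (w j)) = 0" using h_eq[of "d 0 (w j)"] j by (simp add: a_kernel_def')
      then show "h (d 0 (A1.coord a j \<odot>\<^bsub>A (Suc 0)\<^esub> w j)) = 0"
        using j A1.coord_closed[OF a j] A1.basis_closed[OF j]
        by (simp only: left_module_homD(3)[OF d(1)] h_smult d_closed mult_zero_right)
    qed
    finally show ?thesis by simp
  qed
  have "filter_character f g = 1" if g: "g \<in> idempotents S" for g
  proof -
    let ?r = "frag_of g - frag_of \<one>"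
    have r: "?r \<in> carrier ?R"
      using g idempotentD(1)[OF g] keys_diff[of "frag_of g" "frag_of \<one>"] by auto
    have "\<epsilon> (?r \<odot>\<^bsub>A 0\<^esub> x) = 0"
      using x by (simp add: left_module_homD(3)[OF \<epsilon>(1) r] augmentation_linear_extension)
    then have "?r \<odot>\<^bsub>A 0\<^esub> x \<in> d 0 ` carrier (A (Suc 0))"
      using A0.smult_closed[OF r x(1)] d(2) by (simp add: a_kernel_def')
    then have "h (?r \<odot>\<^bsub>A 0\<^esub> x) = 0" using h_d by auto
    then have "?\<chi> ?r * \<epsilon> x = 0" using h_smult[OF x(1) r] h_eq[of x] by simp
    then show ?thesis using x filter_character_one[OF f] by simp
  qed
  then show ?thesis using minimal_idempotentI[OF f] by blast
qed

section \<open>The group ring of the minimal subgroup as a corner\<close>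

text \<open>
  If \<open>x y\<close> and \<open>y x\<close> are idempotent, then \<open>e x y = e = e y x\<close> by minimality of \<open>e\<close>, so that \<open>e y\<close> is an
  inverse of \<open>e x\<close> in \<open>e S\<close>. Thus all elements of the local submonoid are units.
\<close>

lemma maximal_subgroup_sel:
  assumes e: "minimal_idempotent S e"
  shows "carrier (maximal_subgroup S e) = {x \<in> carrier S. e \<otimes> x = x}"
    and "x \<otimes>\<^bsub>maximal_subgroup S e\<^esub> y = x \<otimes> y"
    and "\<one>\<^bsub>maximal_subgroup S e\<^esub> = e"
proof -
  have e': "e \<in> idempotents S" using e by (simp add: minimal_idempotent_def)
  note eS = idempotentD(1)[OF e'] and ee = idempotentD(2)[OF e']
  have fixed: "carrier (local_submonoid S e) = {x \<in> carrier S. e \<otimes> x = x}"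
  proof (intro equalityI subsetI)
    fix y assume "y \<in> carrier (local_submonoid S e)"
    then obtain x where x: "x \<in> carrier S" "y = e \<otimes> x \<otimes> e" by (auto simp: local_submonoid_def)
    have "e \<otimes> y = (e \<otimes> e) \<otimes> x \<otimes> e" using x eS by (simp add: m_assoc)
    then show "y \<in> {x \<in> carrier S. e \<otimes> x = x}" using x eS by (simp add: ee)
  next
    fix y assume "y \<in> {x \<in> carrier S. e \<otimes> x = x}"
    then have y: "y \<in> carrier S" "e \<otimes> y = y" by auto
    then have "y = e \<otimes> y \<otimes> e" using idempotents_central[OF e', of y] by simp
    then show "y \<in> carrier (local_submonoid S e)" using y(1) unfolding local_submonoid_def by simp blast
  qed
  have units: "x \<in> Units (local_submonoid S e)" if x: "x \<in> carrier S" "e \<otimes> x = x" for x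
  proof -
    obtain y where y: "y \<in> carrier S" "x \<otimes> y \<in> idempotents S" "y \<otimes> x \<in> idempotents S"
      using support_idempotent[OF x(1)] .
    have xy: "x \<otimes> (e \<otimes> y) = e"
    proof -
      have "x \<otimes> (e \<otimes> y) = (x \<otimes> e) \<otimes> y" using x y eS by (simp add: m_assoc)
      also have "x \<otimes> e = e \<otimes> x" using idempotents_central[OF e' x(1)] by simp
      also have "e \<otimes> x \<otimes> y = e"
        using x(1) y(1) eS minimal_idempotent_absorbs[OF e y(2)] by (simp add: m_assoc)
      finally show ?thesis .
    qed
    have yx: "e \<otimes> y \<otimes> x = e"
      using x(1) y eS minimal_idempotent_absorbs[OF e y(3)] by (simp add: m_assoc)
    have "e \<otimes> (e \<otimes> y) = e \<otimes> y" using y eS by (simp add: m_assoc[symmetric] ee)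
    then have "e \<otimes> y \<in> carrier (local_submonoid S e)" using y eS by (simp add: fixed)
    moreover have "x \<in> carrier (local_submonoid S e)" using x by (simp add: fixed)
    ultimately show ?thesis using xy yx unfolding Units_def
      by (auto simp: local_submonoid_def)
  qed
  have "Units (local_submonoid S e) \<subseteq> {x \<in> carrier S. e \<otimes> x = x}"
    unfolding fixed[symmetric] by (auto simp: Units_def)
  then have "Units (local_submonoid S e) = {x \<in> carrier S. e \<otimes> x = x}"
    using units by blast
  then show "carrier (maximal_subgroup S e) = {x \<in> carrier S. e \<otimes> x = x}"
    by (simp add: maximal_subgroup_def units_of_def)
qed (simp_all add: maximal_subgroup_def units_of_def local_submonoid_def)

lemma central_idempotent_frag_of:
  assumes e: "e \<in> idempotents S"
  shows "central_idempotent (monoid_ring S) (frag_of e)"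
proof (intro central_idempotent.intro central_idempotent_axioms.intro)
  show "ring (monoid_ring S)" by (rule monoid_ring_is_ring) (rule monoid_axioms)
  show "frag_of e \<otimes>\<^bsub>monoid_ring S\<^esub> p = p \<otimes>\<^bsub>monoid_ring S\<^esub> frag_of e"
    if "p \<in> carrier (monoid_ring S)" for p
  proof -
    have "Poly_Mapping.keys p \<subseteq> carrier S" using that by simp
    then show ?thesis
      by (induction p rule: frag_induction)
        (simp_all add: idempotents_central[OF e] monoid_ring_mult_diff_left monoid_ring_mult_diff_right)
  qed
qed (simp_all add: idempotentD[OF e])

lemma monoid_ring_maximal_subgroup:
  assumes e: "minimal_idempotent S e"
  shows "monoid_ring (maximal_subgroup S e) = central_idempotent.corner_ring (monoid_ring S) (frag_of e)"
proof -
  have e': "e \<in> idempotents S" using e by (simp add: minimal_idempotent_def)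
  note S_assoc = m_assoc
  interpret central_idempotent "monoid_ring S" "frag_of e" by (rule central_idempotent_frag_of[OF e'])
  note eS = idempotentD(1)[OF e'] and ee = idempotentD(2)[OF e']
  have "Poly_Mapping.keys p \<subseteq> {x \<in> carrier S. e \<otimes> x = x} \<longleftrightarrow>
      Poly_Mapping.keys p \<subseteq> carrier S \<and> frag_of e \<otimes>\<^bsub>monoid_ring S\<^esub> p = p" (is "?fixed \<longleftrightarrow> ?corner") for p
  proof
    assume ?fixed
    moreover from this have "frag_of e \<otimes>\<^bsub>monoid_ring S\<^esub> p = p"
      by (induction p rule: frag_induction) (simp_all add: monoid_ring_mult_diff_right)
    ultimately show ?corner by auto
  next
    assume corner: ?corner
    show ?fixed
    proof
      fix x assume x: "x \<in> Poly_Mapping.keys p"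
      then have "x \<in> Poly_Mapping.keys (frag_of e \<otimes>\<^bsub>monoid_ring S\<^esub> p)" using corner by simp
      then obtain y where y: "y \<in> Poly_Mapping.keys p" "x = e \<otimes> y"
        using keys_monoid_ring_mult[of S "frag_of e" p] by auto
      then have "y \<in> carrier S" using corner by blast
      moreover from this have "e \<otimes> (e \<otimes> y) = e \<otimes> y"
        using eS by (simp add: S_assoc[symmetric] ee)
      ultimately show "x \<in> {x \<in> carrier S. e \<otimes> x = x}"
        using y eS by simp
    qed
  qed
  then show ?thesis
    unfolding corner_ring_def by (simp add: monoid_ring_def maximal_subgroup_sel[OF e])
qed

text \<open>
  The augmentation of \<open>e\<close> is 1, so \<open>e\<close> acts as the identity on the trivial module.
\<close>

theorem left_FP_maximal_subgroup_iff:
  assumes e: "minimal_idempotent S e"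
  shows "left_FP n S \<longleftrightarrow> left_FP n (maximal_subgroup S e)"
proof -
  let ?Z = "trivial_module :: ('a \<Rightarrow>\<^sub>0 int, int) module"
  have e': "e \<in> idempotents S" using e by (simp add: minimal_idempotent_def)
  have Z: "left_module (monoid_ring S) ?Z"
    by (rule trivial_module_is_left_module) (rule monoid_axioms)
  interpret central_idempotent "monoid_ring S" "frag_of e" by (rule central_idempotent_frag_of[OF e'])
  have trivial: "frag_of e \<odot>\<^bsub>?Z\<^esub> z = z" for z
    by (simp add: augmentation_linear_extension)
  show ?thesis
    unfolding left_FP_iff monoid_ring_maximal_subgroup[OF e]
  proof (intro iffI; elim exE)
    fix A :: "nat \<Rightarrow> ('a \<Rightarrow>\<^sub>0 int, nat \<Rightarrow> 'a \<Rightarrow>\<^sub>0 int) module" and \<epsilon> d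
    assume "partial_free_resolution (monoid_ring S) ?Z n A \<epsilon> d"
    from partial_free_resolution_corner_module[OF this]
    show "\<exists>A \<epsilon> d. partial_free_resolution corner_ring ?Z n
        (A :: nat \<Rightarrow> ('a \<Rightarrow>\<^sub>0 int, nat \<Rightarrow> 'a \<Rightarrow>\<^sub>0 int) module) \<epsilon> d"
      unfolding corner_module_eq[of ?Z, OF trivial] by blast
  next
    fix A :: "nat \<Rightarrow> ('a \<Rightarrow>\<^sub>0 int, nat \<Rightarrow> 'a \<Rightarrow>\<^sub>0 int) module" and \<epsilon> d
    assume "partial_free_resolution corner_ring ?Z n A \<epsilon> d"
    from partial_free_resolution_from_corner[OF Z trivial this]
    show "\<exists>A \<epsilon> d. partial_free_resolution (monoid_ring S) ?Z n
        (A :: nat \<Rightarrow> ('a \<Rightarrow>\<^sub>0 int, nat \<Rightarrow> 'a \<Rightarrow>\<^sub>0 int) module) \<epsilon> d"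
      by metis
  qed
qed

section \<open>The opposite monoid\<close>

lemma opposite_monoid_sel [simp]:
  "carrier (opposite_monoid T) = carrier T"
  "x \<otimes>\<^bsub>opposite_monoid T\<^esub> y = y \<otimes>\<^bsub>T\<^esub> x"
  "\<one>\<^bsub>opposite_monoid T\<^esub> = \<one>\<^bsub>T\<^esub>"
  by (simp_all add: opposite_monoid_def)

lemma clifford_monoid_opposite: "clifford_monoid (opposite_monoid S)"
proof (intro clifford_monoid.intro clifford_monoid_axioms.intro)
  show "Group.monoid (opposite_monoid S)" by (rule monoidI) (simp_all add: m_assoc)
  fix x assume "x \<in> carrier (opposite_monoid S)"
  then have x: "x \<in> carrier S" by simp
  show "\<exists>y\<in>carrier (opposite_monoid S).
      x \<otimes>\<^bsub>opposite_monoid S\<^esub> y \<otimes>\<^bsub>opposite_monoid S\<^esub> x = x"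
    using regular[OF x] x by (auto simp: m_assoc)
  show "e \<otimes>\<^bsub>opposite_monoid S\<^esub> x = x \<otimes>\<^bsub>opposite_monoid S\<^esub> e"
    if "e \<in> idempotents (opposite_monoid S)" for e
    using that x idempotents_central[of e x] by (simp add: idempotents_def)
qed

lemma minimal_idempotent_opposite:
  "minimal_idempotent (opposite_monoid S) e \<longleftrightarrow> minimal_idempotent S e"
  by (auto simp: minimal_idempotent_def idempotents_def natural_le_def)

lemma maximal_subgroup_opposite:
  assumes "e \<in> carrier S"
  shows "maximal_subgroup (opposite_monoid S) e = opposite_monoid (maximal_subgroup S e)"
proof -
  have "local_submonoid (opposite_monoid S) e = opposite_monoid (local_submonoid S e)"
  proof -
    have "{e \<otimes> (x \<otimes> e) |x. x \<in> carrier S} = {e \<otimes> x \<otimes> e |x. x \<in> carrier S}"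
      by (rule Collect_cong) (metis assms m_assoc)
    then show ?thesis by (simp add: local_submonoid_def opposite_monoid_def)
  qed
  then show ?thesis
    by (auto simp: maximal_subgroup_def units_of_def opposite_monoid_def Units_def)
qed

lemma right_FP_maximal_subgroup_iff:
  assumes e: "minimal_idempotent S e"
  shows "right_FP n S \<longleftrightarrow> right_FP n (maximal_subgroup S e)"
proof -
  interpret op: clifford_monoid "opposite_monoid S" by (rule clifford_monoid_opposite)
  have "e \<in> carrier S" using e by (simp add: minimal_idempotent_def idempotents_def)
  then show ?thesis
    using op.left_FP_maximal_subgroup_iff[of e n] e
    by (simp add: right_FP_def minimal_idempotent_opposite maximal_subgroup_opposite)
qed

end

theorem corollary3:
  fixes S :: "('a, 'b) monoid_scheme" and n :: nat
  assumes "clifford_monoid S" and "n \<ge> 1"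
  shows "type_FP n S \<longleftrightarrow>
    (\<exists>e. minimal_idempotent S e \<and> type_FP n (maximal_subgroup S e))"
proof -
  interpret clifford_monoid S by fact
  have "type_FP n S \<longleftrightarrow> type_FP n (maximal_subgroup S e)" if "minimal_idempotent S e" for e
    using that by (simp add: type_FP_def left_FP_maximal_subgroup_iff right_FP_maximal_subgroup_iff)
  moreover have "\<exists>e. minimal_idempotent S e" if "type_FP n S"
    using that left_FP_imp_minimal_idempotent[OF _ \<open>n \<ge> 1\<close>] by (simp add: type_FP_def)
  ultimately show ?thesis by blast
qed

end
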